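(* Let $X$ be a uniformly locally finite metric space and let $h$ be a self-adjoint operator on $\ell_2(X)$ belonging to $\mathrm{C}^*_{u,unb}(X)$ and such that \[ \sup\{|\langle h\delta_y,\delta_x\rangle| : x,y\in X,\ x\neq y\}<\infty. \] Then $e^{ih}\in\mathrm{C}^*_{ql}(X)$. In particular, if $h$ (self-adjoint, in $\mathrm{C}^*_{u,unb}(X)$) is a coarse operator, then $e^{ih}\in\mathrm{C}^*_{ql}(X)$.
   Context: Uniformly locally finite: $\sup_x|B_r(x)|<\infty$ for all $r>0$. $(\delta_x)$ is the canonical basis of $\ell_2(X)$, $c_{00}(X)$ the finitely supported vectors, $p_A$ the orthogonal projection onto $\ell_2(A)$. An operator $h$ (possibly unbounded) is admissible if it is closed, $c_{00}(X)\subseteq\mathrm{dom}(h)$ and $h\xi=\sum_y\langle\xi,\delta_y\rangle h\delta_y$ for all $\xi\in\mathrm{dom}(h)$; it has finite propagation if it is admissible and $\sup\{d(x,y):\langle h\delta_x,\delta_y\rangle\neq0\}<\infty$. $\mathrm{C}^*_{u,unb}(X)$ is the set of admissible $h$ such that for every $\varepsilon>0$ there is a finite propagation $h'$ with $h-h'$ (on $\mathrm{dom}(h)\cap\mathrm{dom}(h')$) bounded with norm at most $\varepsilon$. The quasi-local algebra $\mathrm{C}^*_{ql}(X)$ consists of all $a\in\mathcal{B}(\ell_2(X))$ such that for every $\varepsilon>0$ there is $r>0$ with $\|p_Aap_B\|\le\varepsilon$ whenever $A,B\subseteq X$ satisfy $d(A,B)>r$. A partial translation is a bijection $f\colon\mathrm{dom}(f)\subseteq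 X\to\mathrm{ran}(f)\subseteq X$ with $\sup_{x}d(x,f(x))<\infty$, with $v_f\delta_x=\delta_{f(x)}$ on $\mathrm{dom}(f)$ and $0$ elsewhere; a closed operator $h$ is coarse if $v_f(\mathrm{dom}(h))\subseteq\mathrm{dom}(h)$ and $hv_f-v_fh$ is bounded on $\mathrm{dom}(h)$ for all partial translations $f$. *)

theory Defs
  imports "HOL-Analysis.Analysis" "HOL-Library.Function_Algebras"
begin

text \<open>The metric space X is the universe of a type of class metric_space.
  Vectors of l2(X) are functions X -> complex that are square summable.
  A (possibly unbounded) operator h is given by a pair: its domain D and its action T.\<close>

type_synonym 'a vec = "'a \<Rightarrow> complex"

definition unif_loc_finite :: "'a::metric_space itself \<Rightarrow> bool" where
  "unif_loc_finite _ \<longleftrightarrow>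
     (\<forall>r>0. \<exists>N::nat. \<forall>x::'a. finite (cball x r) \<and> card (cball x r) \<le> N)"

definition l2 :: "'a vec set" where
  "l2 = {f. (\<lambda>x. (cmod (f x))\<^sup>2) summable_on UNIV}"

definition l2norm :: "'a vec \<Rightarrow> real" where
  "l2norm f = sqrt (infsum (\<lambda>x. (cmod (f x))\<^sup>2) UNIV)"

definition l2inner :: "'a vec \<Rightarrow> 'a vec \<Rightarrow> complex" where
  "l2inner f g = infsum (\<lambda>x. f x * cnj (g x)) UNIV"

definition delta :: "'a \<Rightarrow> 'a vec" where
  "delta x = (\<lambda>y. if y = x then 1 else 0)"

definition c00 :: "'a vec set" where
  "c00 = {f. finite {x. f x \<noteq> 0}}"

definition proj :: "'a set \<Rightarrow> 'a vec \<Rightarrow> 'a vec" where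
  "proj A f = (\<lambda>x. if x \<in> A then f x else 0)"

definition scv :: "complex \<Rightarrow> 'a vec \<Rightarrow> 'a vec" where
  "scv c f = (\<lambda>x. c * f x)"

definition lin_op :: "'a vec set \<Rightarrow> ('a vec \<Rightarrow> 'a vec) \<Rightarrow> bool" where
  "lin_op D T \<longleftrightarrow> D \<subseteq> l2 \<and> 0 \<in> D \<and>
     (\<forall>f\<in>D. \<forall>g\<in>D. f + g \<in> D \<and> T (f + g) = T f + T g) \<and>
     (\<forall>c. \<forall>f\<in>D. scv c f \<in> D \<and> T (scv c f) = scv c (T f)) \<and>
     (\<forall>f\<in>D. T f \<in> l2)"

definition closed_op :: "'a vec set \<Rightarrow> ('a vec \<Rightarrow> 'a vec) \<Rightarrow> bool" where
  "closed_op D T \<longleftrightarrow> lin_op D T \<and>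
     (\<forall>s \<xi> \<eta>. (\<forall>n. s n \<in> D) \<and> \<xi> \<in> l2 \<and> \<eta> \<in> l2 \<and>
        (\<lambda>n. l2norm (s n - \<xi>)) \<longlonglongrightarrow> 0 \<and> (\<lambda>n. l2norm (T (s n) - \<eta>)) \<longlonglongrightarrow> 0
        \<longrightarrow> \<xi> \<in> D \<and> T \<xi> = \<eta>)"

definition admissible :: "'a vec set \<Rightarrow> ('a vec \<Rightarrow> 'a vec) \<Rightarrow> bool" where
  "admissible D T \<longleftrightarrow> closed_op D T \<and> (l2 \<inter> c00) \<subseteq> D \<and>
     (\<forall>\<xi>\<in>D. \<forall>x. ((\<lambda>y. l2inner \<xi> (delta y) * T (delta y) x) has_sum T \<xi> x) UNIV)"

definition finite_prop :: "'a::metric_space vec set \<Rightarrow> ('a vec \<Rightarrow> 'a vec) \<Rightarrow> bool" where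
  "finite_prop D T \<longleftrightarrow> admissible D T \<and>
     (\<exists>R. \<forall>x y. l2inner (T (delta x)) (delta y) \<noteq> 0 \<longrightarrow> dist x y \<le> R)"

definition in_Cu_unb :: "'a::metric_space vec set \<Rightarrow> ('a vec \<Rightarrow> 'a vec) \<Rightarrow> bool" where
  "in_Cu_unb D T \<longleftrightarrow> admissible D T \<and>
     (\<forall>\<epsilon>>0. \<exists>D' T'. finite_prop D' T' \<and>
        (\<forall>\<xi>\<in>D \<inter> D'. l2norm (T \<xi> - T' \<xi>) \<le> \<epsilon> * l2norm \<xi>))"

text \<open>Self-adjoint (densely defined, since c00 is in the domain for admissible h):
  symmetric and the domain of the adjoint equals D.\<close>
definition self_adjoint :: "'a vec set \<Rightarrow> ('a vec \<Rightarrow> 'a vec) \<Rightarrow> bool" where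
  "self_adjoint D T \<longleftrightarrow> lin_op D T \<and>
     (\<forall>\<xi>\<in>D. \<forall>\<eta>\<in>D. l2inner (T \<xi>) \<eta> = l2inner \<xi> (T \<eta>)) \<and>
     (\<forall>\<eta>\<in>l2. \<eta> \<in> D \<longleftrightarrow> (\<exists>\<zeta>\<in>l2. \<forall>\<xi>\<in>D. l2inner (T \<xi>) \<eta> = l2inner \<xi> \<zeta>))"

definition unitary :: "('a vec \<Rightarrow> 'a vec) \<Rightarrow> bool" where
  "unitary U \<longleftrightarrow> lin_op l2 U \<and> (\<forall>\<xi>\<in>l2. l2norm (U \<xi>) = l2norm \<xi>) \<and> U ` l2 = l2"

text \<open>exp(ih) via Stone's theorem: W is the strongly continuous one-parameter unitary
  group whose (infinitesimal) generator is i h, and e^{ih} = W 1.\<close>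
definition generated_group ::
    "'a vec set \<Rightarrow> ('a vec \<Rightarrow> 'a vec) \<Rightarrow> (real \<Rightarrow> 'a vec \<Rightarrow> 'a vec) \<Rightarrow> bool" where
  "generated_group D T W \<longleftrightarrow>
     (\<forall>t. unitary (W t)) \<and>
     (\<forall>\<xi>\<in>l2. W 0 \<xi> = \<xi>) \<and>
     (\<forall>s t. \<forall>\<xi>\<in>l2. W (s + t) \<xi> = W s (W t \<xi>)) \<and>
     (\<forall>\<xi>\<in>l2. \<forall>t0. ((\<lambda>t. l2norm (W t \<xi> - W t0 \<xi>)) \<longlongrightarrow> 0) (at t0)) \<and>
     (\<forall>\<xi>\<in>l2. \<xi> \<in> D \<longleftrightarrow>
        (\<exists>\<eta>\<in>l2. ((\<lambda>t. l2norm (scv (complex_of_real (1 / t)) (W t \<xi> - \<xi>) - \<eta>)) \<longlongrightarrow> 0) (at 0))) \<and>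
     (\<forall>\<xi>\<in>D. ((\<lambda>t. l2norm (scv (complex_of_real (1 / t)) (W t \<xi> - \<xi>) - scv \<i> (T \<xi>))) \<longlongrightarrow> 0) (at 0))"

definition is_exp_ih :: "'a vec set \<Rightarrow> ('a vec \<Rightarrow> 'a vec) \<Rightarrow> ('a vec \<Rightarrow> 'a vec) \<Rightarrow> bool" where
  "is_exp_ih D T U \<longleftrightarrow> (\<exists>W. generated_group D T W \<and> (\<forall>\<xi>\<in>l2. U \<xi> = W 1 \<xi>))"

definition quasi_local :: "('a::metric_space vec \<Rightarrow> 'a vec) \<Rightarrow> bool" where
  "quasi_local a \<longleftrightarrow> lin_op l2 a \<and> (\<exists>C. \<forall>\<xi>\<in>l2. l2norm (a \<xi>) \<le> C * l2norm \<xi>) \<and>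
     (\<forall>\<epsilon>>0. \<exists>r>0. \<forall>A B. setdist A B > r \<longrightarrow>
        (\<forall>\<xi>\<in>l2. l2norm (proj A (a (proj B \<xi>))) \<le> \<epsilon> * l2norm \<xi>))"

definition partial_translation :: "'a::metric_space set \<Rightarrow> ('a \<Rightarrow> 'a) \<Rightarrow> bool" where
  "partial_translation S f \<longleftrightarrow> inj_on f S \<and> (\<exists>R. \<forall>x\<in>S. dist x (f x) \<le> R)"

definition vtrans :: "'a set \<Rightarrow> ('a \<Rightarrow> 'a) \<Rightarrow> 'a vec \<Rightarrow> 'a vec" where
  "vtrans S f \<xi> = (\<lambda>y. if y \<in> f ` S then \<xi> (the_inv_into S f y) else 0)"

definition coarse_op :: "'a::metric_space vec set \<Rightarrow> ('a vec \<Rightarrow> 'a vec) \<Rightarrow> bool" where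
  "coarse_op D T \<longleftrightarrow> closed_op D T \<and>
     (\<forall>S f. partial_translation S f \<longrightarrow>
        vtrans S f ` D \<subseteq> D \<and>
        (\<exists>C. \<forall>\<xi>\<in>D. l2norm (T (vtrans S f \<xi>) - vtrans S f (T \<xi>)) \<le> C * l2norm \<xi>))"

end

theory Submission
  imports Defs
begin

text \<open>Since \<open>h\<close> is close to a finite propagation operator and its off-diagonal entries are bounded,
  uniform local finiteness (Schur test) makes the off-diagonal part \<open>B\<close> of \<open>h\<close> bounded. Hence
  \<open>h = d + B\<close> with \<open>d\<close> a real diagonal operator, and the domain of \<open>h\<close> is that of \<open>d\<close>. The group
  \<open>exp(ith)\<close> is \<open>exp(itd) V(t)\<close>, where \<open>V\<close> solves the linear equation
  \<open>V' = i exp(-itd) B exp(itd) V\<close> with bounded, strongly continuous coefficients.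

  For quasi-locality let \<open>\<phi>\<close> be a multiplication operator by a function with values in \<open>[0,1]\<close> that
  vanishes on one set, is 1 on the other, and is \<open>1/r\<close>-Lipschitz, where \<open>r\<close> is less than the distance of the sets.
  It commutes with \<open>d\<close>, so by Duhamel's formula the norm of \<open>[\<phi>, exp(ih)]\<close> is at most that of \<open>[\<phi>, B]\<close>,
  which tends to 0 as \<open>r\<close> grows because \<open>B\<close> is approximated by finite propagation matrices.\<close>

subsection \<open>The Hilbert space of square summable functions\<close>

text \<open>Since d may be unbounded, exp(ith) cannot be summed as a power series in h. Passing to V
  removes d, but the coefficients that remain are only strongly continuous in t, so a Picard series
  is summed vector by vector and not in operator norm. The commutator estimate is made for an
  arbitrary group with generator ih, from the group axioms alone, and in weak form: both vectors of
  the pairing lie in the domain, so that each factor can be differentiated, and density finishes.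
  Deleting the diagonal is what makes the approximants usable: a finite propagation h' close to h
  inherits bounded entries only away from the diagonal, and there the Schur test applies, with at
  most N entries per row and column. The inclusion of the domain of d in that of h comes from
  self-adjointness, because d + B is a symmetric extension of h. A coarse h falls under the same
  argument: its commutators with coordinate projections already force the off-diagonal entries to be
  bounded.\<close>

lemma l2I:
  assumes "\<And>S. finite S \<Longrightarrow> (\<Sum>x\<in>S. (cmod (f x))\<^sup>2) \<le> C"
  shows "f \<in> l2"
  unfolding l2_def
  by (auto intro!: nonneg_bdd_above_summable_on bdd_aboveI2[where M = C] assms)

lemma l2norm_nonneg [simp]: "0 \<le> l2norm f"
  by (simp add: l2norm_def infsum_nonneg)

lemma l2norm_square: "(l2norm f)\<^sup>2 = infsum (\<lambda>x. (cmod (f x))\<^sup>2) UNIV"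
  by (simp add: l2norm_def infsum_nonneg)

lemma sum_le_l2norm:
  assumes "f \<in> l2" "finite S"
  shows "(\<Sum>x\<in>S. (cmod (f x))\<^sup>2) \<le> (l2norm f)\<^sup>2"
  unfolding l2norm_square using assms by (intro finite_sum_le_infsum) (auto simp: l2_def)

lemma l2norm_le:
  assumes "\<And>S. finite S \<Longrightarrow> (\<Sum>x\<in>S. (cmod (f x))\<^sup>2) \<le> C\<^sup>2" "0 \<le> C"
  shows "l2norm f \<le> C"
proof -
  have "f \<in> l2" by (rule l2I) (rule assms)
  hence "(l2norm f)\<^sup>2 \<le> C\<^sup>2"
    unfolding l2norm_square by (intro infsum_le_finite_sums assms) (auto simp: l2_def)
  thus ?thesis using assms(2) by (rule power2_le_imp_le)
qed

lemma cmod_le_l2norm: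
  assumes "f \<in> l2" shows "cmod (f x) \<le> l2norm f"
  using sum_le_l2norm[OF assms, of "{x}"] by (auto intro: power2_le_imp_le)

lemma l2_mono:
  assumes "g \<in> l2" "\<And>x. cmod (f x) \<le> C * cmod (g x)"
  shows "f \<in> l2"
proof (rule l2I)
  fix S :: "'a set" assume S: "finite S"
  have "(\<Sum>x\<in>S. (cmod (f x))\<^sup>2) \<le> (\<Sum>x\<in>S. C\<^sup>2 * (cmod (g x))\<^sup>2)"
    by (intro sum_mono) (simp add: power_mono assms flip: power_mult_distrib)
  also have "\<dots> \<le> C\<^sup>2 * (l2norm g)\<^sup>2"
    unfolding sum_distrib_left[symmetric] by (intro mult_left_mono sum_le_l2norm assms S) auto
  finally show "(\<Sum>x\<in>S. (cmod (f x))\<^sup>2) \<le> C\<^sup>2 * (l2norm g)\<^sup>2" .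
qed

lemma l2norm_mono:
  assumes "g \<in> l2" "\<And>x. cmod (f x) \<le> C * cmod (g x)" "0 \<le> C"
  shows "l2norm f \<le> C * l2norm g"
proof (rule l2norm_le)
  fix S :: "'a set" assume S: "finite S"
  have "(\<Sum>x\<in>S. (cmod (f x))\<^sup>2) \<le> (\<Sum>x\<in>S. C\<^sup>2 * (cmod (g x))\<^sup>2)"
    by (intro sum_mono) (simp add: power_mono assms flip: power_mult_distrib)
  also have "\<dots> \<le> C\<^sup>2 * (l2norm g)\<^sup>2"
    unfolding sum_distrib_left[symmetric] by (intro mult_left_mono sum_le_l2norm assms S) auto
  finally show "(\<Sum>x\<in>S. (cmod (f x))\<^sup>2) \<le> (C * l2norm g)\<^sup>2"
    by (simp add: power_mult_distrib)
qed (use assms in auto)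

lemma l2_zero: "(\<lambda>_. 0) \<in> l2"
  by (simp add: l2_def)

lemma l2_add:
  assumes "f \<in> l2" "g \<in> l2" shows "(\<lambda>x. f x + g x) \<in> l2"
proof (rule l2I)
  fix S :: "'a set" assume S: "finite S"
  have "(cmod (f x + g x))\<^sup>2 \<le> 2 * (cmod (f x))\<^sup>2 + 2 * (cmod (g x))\<^sup>2" for x
  proof -
    have "(cmod (f x + g x))\<^sup>2 \<le> (cmod (f x) + cmod (g x))\<^sup>2"
      by (intro power_mono norm_triangle_ineq) auto
    also have "\<dots> \<le> 2 * (cmod (f x))\<^sup>2 + 2 * (cmod (g x))\<^sup>2"
      using zero_le_power2[of "cmod (f x) - cmod (g x)"] by (simp add: power2_eq_square algebra_simps)
    finally show ?thesis .
  qed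
  hence "(\<Sum>x\<in>S. (cmod (f x + g x))\<^sup>2) \<le> (\<Sum>x\<in>S. 2 * (cmod (f x))\<^sup>2 + 2 * (cmod (g x))\<^sup>2)"
    by (intro sum_mono)
  also have "\<dots> \<le> 2 * (l2norm f)\<^sup>2 + 2 * (l2norm g)\<^sup>2"
    unfolding sum.distrib sum_distrib_left[symmetric]
    by (intro add_mono mult_left_mono sum_le_l2norm assms S) auto
  finally show "(\<Sum>x\<in>S. (cmod (f x + g x))\<^sup>2) \<le> 2 * (l2norm f)\<^sup>2 + 2 * (l2norm g)\<^sup>2" .
qed

lemma l2_cmult: "f \<in> l2 \<Longrightarrow> (\<lambda>x. c * f x) \<in> l2"
  by (erule l2_mono[where C = "cmod c"]) (simp add: norm_mult)

lemma l2_uminus: "f \<in> l2 \<Longrightarrow> (\<lambda>x. - f x) \<in> l2"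
  by (erule l2_mono[where C = 1]) simp

lemma l2_diff: "f \<in> l2 \<Longrightarrow> g \<in> l2 \<Longrightarrow> (\<lambda>x. f x - g x) \<in> l2"
  using l2_add[of f "\<lambda>x. - g x"] l2_uminus[of g] by simp

lemma l2_mult_summable:
  assumes "f \<in> l2" "g \<in> l2"
  shows "(\<lambda>x. f x * cnj (g x)) summable_on UNIV"
proof -
  have "(\<lambda>x. (cmod (f x))\<^sup>2 + (cmod (g x))\<^sup>2) summable_on UNIV"
    using assms by (intro summable_on_add) (auto simp: l2_def)
  hence "(\<lambda>x. cmod (f x * cnj (g x))) summable_on UNIV"
  proof (rule summable_on_comparison_test)
    fix x
    have "2 * (cmod (f x) * cmod (g x)) \<le> (cmod (f x))\<^sup>2 + (cmod (g x))\<^sup>2"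
      using zero_le_power2[of "cmod (f x) - cmod (g x)"] by (simp add: power2_eq_square algebra_simps)
    thus "cmod (f x * cnj (g x)) \<le> (cmod (f x))\<^sup>2 + (cmod (g x))\<^sup>2"
      using mult_nonneg_nonneg[of "cmod (f x)" "cmod (g x)"] unfolding norm_mult complex_mod_cnj
      by (smt (verit) norm_ge_zero)
  qed auto
  thus ?thesis by (rule abs_summable_summable)
qed

lemma c00_l2: "f \<in> c00 \<Longrightarrow> f \<in> l2"
  unfolding l2_def c00_def mem_Collect_eq
  by (rule finite_nonzero_values_imp_summable_on) auto

text \<open>The function type carries no norm, whereas derivatives, Cauchy-Schwarz and completeness
  are type-class notions; hence a separate type for the square summable functions.\<close>

typedef 'a ell2 = "l2 :: 'a vec set"
  morphisms coord ell2_of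
  using l2_zero by blast

declare coord_inverse [simp] ell2_of_inverse [simp] coord [simp]

lemma ell2_eqI: "(\<And>x. coord f x = coord g x) \<Longrightarrow> f = g"
  by (auto simp: coord_inject[symmetric])

text \<open>Only the real Hilbert space structure is declared, with \<open>inner\<close> the real
  part of the complex inner product; norms and derivatives in real time need no more. The complex
  structure is kept as the operator \<open>imul\<close>, from which \<open>l2inner_coord\<close>
  recovers the complex inner product.\<close>

instantiation ell2 :: (type) real_inner
begin

definition zero_ell2 :: "'a ell2" where "0 = ell2_of (\<lambda>_. 0)"
definition plus_ell2 :: "'a ell2 \<Rightarrow> 'a ell2 \<Rightarrow> 'a ell2"
  where "f + g = ell2_of (\<lambda>x. coord f x + coord g x)"
definition minus_ell2 :: "'a ell2 \<Rightarrow> 'a ell2 \<Rightarrow> 'a ell2"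
  where "f - g = ell2_of (\<lambda>x. coord f x - coord g x)"
definition uminus_ell2 :: "'a ell2 \<Rightarrow> 'a ell2"
  where "- f = ell2_of (\<lambda>x. - coord f x)"
definition scaleR_ell2 :: "real \<Rightarrow> 'a ell2 \<Rightarrow> 'a ell2"
  where "c *\<^sub>R f = ell2_of (\<lambda>x. of_real c * coord f x)"
definition inner_ell2 :: "'a ell2 \<Rightarrow> 'a ell2 \<Rightarrow> real"
  where "inner (f :: 'a ell2) g = infsum (\<lambda>x. Re (coord f x * cnj (coord g x))) UNIV"
definition norm_ell2 :: "'a ell2 \<Rightarrow> real" where "norm (f :: 'a ell2) = sqrt (inner f f)"
definition sgn_ell2 :: "'a ell2 \<Rightarrow> 'a ell2" where "sgn (f :: 'a ell2) = inverse (norm f) *\<^sub>R f"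
definition dist_ell2 :: "'a ell2 \<Rightarrow> 'a ell2 \<Rightarrow> real" where "dist (f :: 'a ell2) g = norm (f - g)"
definition uniformity_ell2 :: "('a ell2 \<times> 'a ell2) filter"
  where "uniformity_ell2 = (INF e\<in>{0<..}. principal {(f :: 'a ell2, g). dist f g < e})"
definition open_ell2 :: "'a ell2 set \<Rightarrow> bool"
  where "open_ell2 (U :: 'a ell2 set) = (\<forall>x\<in>U. \<forall>\<^sub>F (x', y) in uniformity. x' = x \<longrightarrow> y \<in> U)"

lemma coord_0 [simp]: "coord 0 x = 0"
  by (simp add: zero_ell2_def l2_zero)

lemma coord_add [simp]: "coord (f + g) x = coord f x + coord g x"
  by (simp add: plus_ell2_def l2_add)

lemma coord_diff [simp]: "coord (f - g) x = coord f x - coord g x"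
  by (simp add: minus_ell2_def l2_diff)

lemma coord_uminus [simp]: "coord (- f) x = - coord f x"
  by (simp add: uminus_ell2_def l2_uminus)

lemma coord_scaleR [simp]: "coord (c *\<^sub>R f) x = of_real c * coord f x"
  by (simp add: scaleR_ell2_def l2_cmult)

lemma inner_ell2_summable: "(\<lambda>x. Re (coord f x * cnj (coord g x))) summable_on UNIV"
  by (intro summable_on_Re l2_mult_summable) auto

instance
proof
  fix f g h :: "'a ell2" and a b :: real
  show "f + g + h = f + (g + h)" "f + g = g + f" "0 + f = f" "- f + f = 0" "f - g = f + - g"
    "a *\<^sub>R (f + g) = a *\<^sub>R f + a *\<^sub>R g" "(a + b) *\<^sub>R f = a *\<^sub>R f + b *\<^sub>R f"
    "a *\<^sub>R b *\<^sub>R f = (a * b) *\<^sub>R f" "1 *\<^sub>R f = f"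
    by (auto intro!: ell2_eqI simp: algebra_simps)
  show "dist f g = norm (f - g)" "sgn f = inverse (norm f) *\<^sub>R f" "norm f = sqrt (inner f f)"
    by (simp_all add: dist_ell2_def sgn_ell2_def norm_ell2_def)
  show "(uniformity :: ('a ell2 \<times> 'a ell2) filter) = (INF e\<in>{0<..}. principal {(f, g). dist f g < e})"
    by (simp add: uniformity_ell2_def)
  show "open U = (\<forall>x\<in>U. \<forall>\<^sub>F (x', y) in uniformity. x' = x \<longrightarrow> y \<in> U)" for U :: "'a ell2 set"
    by (simp add: open_ell2_def)
  show "inner f g = inner g f"
    unfolding inner_ell2_def by (rule infsum_cong) (simp add: algebra_simps)
  show "inner (f + g) h = inner f h + inner g h"
    unfolding inner_ell2_def
    by (simp only: infsum_add[OF inner_ell2_summable inner_ell2_summable, symmetric])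
       (auto intro!: infsum_cong simp: algebra_simps)
  show "inner (a *\<^sub>R f) g = a * inner f g"
    unfolding inner_ell2_def
    by (subst infsum_cmult_right'[symmetric]) (auto intro!: infsum_cong simp: algebra_simps)
  have eq: "Re (coord f x * cnj (coord f x)) = (cmod (coord f x))\<^sup>2" for x
    by (simp only: complex_norm_square[symmetric] Re_complex_of_real)
  show "0 \<le> inner f f"
    unfolding inner_ell2_def eq by (intro infsum_nonneg) auto
  show "inner f f = 0 \<longleftrightarrow> f = 0"
  proof
    assume 0: "inner f f = 0"
    have "(cmod (coord f x))\<^sup>2 = 0" for x
    proof (rule nonneg_infsum_le_0D[where A = UNIV and f = "\<lambda>x. (cmod (coord f x))\<^sup>2"])
      show "(\<Sum>\<^sub>\<infinity>x. (cmod (coord f x))\<^sup>2) \<le> 0" using 0 unfolding inner_ell2_def eq by simp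
      show "(\<lambda>x. (cmod (coord f x))\<^sup>2) summable_on UNIV" using inner_ell2_summable[of f f] unfolding eq .
    qed auto
    thus "f = 0" by (intro ell2_eqI) auto
  qed (simp add: inner_ell2_def)
qed

end

lemma norm_ell2_l2norm: "norm f = l2norm (coord f)"
proof -
  have eq: "Re (coord f x * cnj (coord f x)) = (cmod (coord f x))\<^sup>2" for x
    by (simp only: complex_norm_square[symmetric] Re_complex_of_real)
  show ?thesis unfolding norm_eq_sqrt_inner inner_ell2_def l2norm_def eq ..
qed

lemma inner_ell2_l2inner: "inner f g = Re (l2inner (coord f) (coord g))"
  unfolding inner_ell2_def l2inner_def by (intro infsum_Re l2_mult_summable) auto

lemma sum_le_norm_ell2: "finite S \<Longrightarrow> (\<Sum>x\<in>S. (cmod (coord f x))\<^sup>2) \<le> (norm f)\<^sup>2"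
  unfolding norm_ell2_l2norm by (rule sum_le_l2norm) auto

lemma cmod_coord_le: "cmod (coord f x) \<le> norm f"
  unfolding norm_ell2_l2norm by (rule cmod_le_l2norm) auto

lemma coord_sum [simp]: "coord (sum f S) x = (\<Sum>i\<in>S. coord (f i) x)"
  by (induction S rule: infinite_finite_induct) auto

lemma bounded_linear_coord: "bounded_linear (\<lambda>f. coord f x)"
  by (rule bounded_linear_intro[where K = 1]) (auto simp: cmod_coord_le scaleR_conv_of_real)

instance ell2 :: (type) banach
proof
  fix X :: "nat \<Rightarrow> 'a ell2" assume X: "Cauchy X"
  have "convergent (\<lambda>n. coord (X n) x)" for x
    using bounded_linear.Cauchy[OF bounded_linear_coord X] by (rule Cauchy_convergent)
  then obtain f where f: "\<And>x. (\<lambda>n. coord (X n) x) \<longlonglongrightarrow> f x"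
    unfolding convergent_def by metis
  \<comment> \<open>Bounds on finite coordinate sums survive the coordinatewise limit in
    \<open>m\<close>. They give both the square summability of the limit and the convergence in
    norm.\<close>
  have bound: "(\<Sum>x\<in>S. (cmod (coord (X n) x - f x))\<^sup>2) \<le> e\<^sup>2"
    if S: "finite S" and N: "\<And>m. m \<ge> N \<Longrightarrow> norm (X n - X m) \<le> e" for S n N e
  proof (rule tendsto_upperbound)
    show "(\<lambda>m. \<Sum>x\<in>S. (cmod (coord (X n) x - coord (X m) x))\<^sup>2) \<longlonglongrightarrow> (\<Sum>x\<in>S. (cmod (coord (X n) x - f x))\<^sup>2)"
      by (intro tendsto_intros f)
    have "(\<Sum>x\<in>S. (cmod (coord (X n) x - coord (X m) x))\<^sup>2) \<le> e\<^sup>2" if m: "m \<ge> N" for m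
      using sum_le_norm_ell2[OF S, of "X n - X m"] power_mono[OF N[OF m], of 2] by simp
    thus "\<forall>\<^sub>F m in sequentially. (\<Sum>x\<in>S. (cmod (coord (X n) x - coord (X m) x))\<^sup>2) \<le> e\<^sup>2"
      by (auto simp: eventually_sequentially)
  qed auto
  obtain N1 where "\<And>m. m \<ge> N1 \<Longrightarrow> norm (X N1 - X m) \<le> 1"
    using CauchyD[OF X, of 1] by (meson less_imp_le order_refl zero_less_one)
  hence "(\<lambda>x. coord (X N1) x - f x) \<in> l2" using bound by (intro l2I) blast
  from l2_diff[OF coord[of "X N1"] this] have fl: "f \<in> l2" by simp
  have "X \<longlonglongrightarrow> ell2_of f"
  proof (rule LIMSEQ_I)
    fix r :: real assume r: "0 < r"
    obtain M where M: "\<And>m n. m \<ge> M \<Longrightarrow> n \<ge> M \<Longrightarrow> norm (X m - X n) < r / 2"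
      using CauchyD[OF X, of "r / 2"] r by auto
    have "norm (X n - ell2_of f) < r" if n: "n \<ge> M" for n
    proof -
      have "l2norm (coord (X n - ell2_of f)) \<le> r / 2"
        using bound[of _ M n "r / 2"] M n r fl by (intro l2norm_le) (auto intro: less_imp_le)
      thus ?thesis using r by (simp add: norm_ell2_l2norm)
    qed
    thus "\<exists>no. \<forall>n\<ge>no. norm (X n - ell2_of f) < r" by blast
  qed
  thus "convergent X" by (auto simp: convergent_def)
qed

subsection \<open>Linear differential equations with strongly continuous coefficients\<close>

lemma antiderivative_real_exists:
  fixes g :: "real \<Rightarrow> 'b::banach"
  assumes g: "continuous_on UNIV g"
  obtains G where "G 0 = 0" "\<And>t. (G has_vector_derivative g t) (at t)"
proof -
  \<comment> \<open>For either sign of \<open>t\<close> one of the two intervals has at most one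
    point, so \<open>G t\<close> is the oriented integral from 0 to \<open>t\<close>.\<close>
  define G where "G t = integral {0..t} g - integral {t..0} g" for t
  have int: "g integrable_on {a..b}" for a b
    using g by (intro integrable_continuous_real) (rule continuous_on_subset, auto)
  have "(G has_vector_derivative g t) (at t)" for t
  proof -
    \<comment> \<open>The interval from \<open>a\<close> to \<open>b\<close> contains 0 and has
      \<open>t\<close> in its interior; on it \<open>G\<close> differs by a constant from the
      integral starting at \<open>a\<close>.\<close>
    define a where "a = - \<bar>t\<bar> - 1"
    define b where "b = \<bar>t\<bar> + 1"
    have G: "integral {a..s} g - integral {a..0} g = G s" if "s \<in> {a..b}" for s
    proof (cases "0 \<le> s")
      case True
      have "integral {a..0} g + integral {0..s} g = integral {a..s} g"
        using True int by (intro Henstock_Kurzweil_Integration.integral_combine) (auto simp: a_def)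
      moreover have "integral {s..0} g = 0" using True by (cases "s = 0") auto
      ultimately show ?thesis unfolding G_def by (metis add_diff_cancel_left' diff_zero)
    next
      case False
      have "integral {a..s} g + integral {s..0} g = integral {a..0} g"
        using False that int by (intro Henstock_Kurzweil_Integration.integral_combine) (auto simp: a_def)
      moreover have "integral {0..s} g = 0" using False by auto
      ultimately show ?thesis by (simp add: G_def algebra_simps)
    qed
    have t: "t \<in> {a<..<b}" by (auto simp: a_def b_def)
    have "((\<lambda>s. integral {a..s} g) has_vector_derivative g t) (at t within {a..b})"
      using t by (intro integral_has_vector_derivative continuous_on_subset[OF g]) auto
    hence "((\<lambda>s. integral {a..s} g - integral {a..0} g) has_vector_derivative g t) (at t within {a..b})"
      using has_vector_derivative_diff[OF _ has_vector_derivative_const] by fastforce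
    hence "(G has_vector_derivative g t) (at t within {a..b})"
      by (rule has_vector_derivative_transform[rotated 2]) (use t G in auto)
    moreover have "at t within {a..b} = at t" using t by (intro at_within_Icc_at) auto
    ultimately show ?thesis by simp
  qed
  thus thesis by (intro that[of G]) (auto simp: G_def)
qed

text \<open>The induction step of the factorial estimate for Picard iterates. The mean value
  inequality runs forward in time, so negative \<open>t\<close> is reached by reflecting
  \<open>G\<close>.\<close>

lemma norm_primitive_le:
  fixes G :: "real \<Rightarrow> 'b::real_normed_vector"
  assumes "G 0 = 0" "\<And>t. (G has_vector_derivative g t) (at t)" "\<And>t. norm (g t) \<le> C * \<bar>t\<bar> ^ n"
  shows "norm (G t) \<le> C * \<bar>t\<bar> ^ Suc n / Suc n"
proof -
  have pos: "norm (G t) \<le> C * t ^ Suc n / Suc n"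
    if t: "0 < t" and 0: "G 0 = 0" and G: "\<And>t. (G has_vector_derivative g t) (at t)"
      and g: "\<And>t. norm (g t) \<le> C * \<bar>t\<bar> ^ n" for G g :: "real \<Rightarrow> 'b" and t
  proof -
    have "norm (G t - G 0) \<le> C * t ^ Suc n / Suc n - C * 0 ^ Suc n / Suc n"
    proof (rule differentiable_bound_general[OF t, where f' = g and \<phi>' = "\<lambda>s. C * s ^ n"])
      show "continuous_on {0..t} G"
        using G by (intro continuous_at_imp_continuous_on ballI) (rule has_vector_derivative_continuous)
      show "((\<lambda>s. C * s ^ Suc n / Suc n) has_vector_derivative C * s ^ n) (at s)" for s
      proof -
        have "((\<lambda>s. C * s ^ Suc n / Suc n) has_real_derivative C * (Suc n * s ^ n) / Suc n) (at s)"
          by (auto intro!: derivative_eq_intros simp del: power_Suc of_nat_Suc)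
        thus ?thesis by (simp add: has_real_derivative_iff_has_vector_derivative del: power_Suc of_nat_Suc)
      qed
      show "norm (g s) \<le> C * s ^ n" if "0 < s" for s using g[of s] that by simp
    qed (use G in \<open>auto intro!: continuous_intros\<close>)
    thus ?thesis using 0 by simp
  qed
  consider "t = 0" | "t > 0" | "t < 0" by linarith
  thus ?thesis
  proof cases
    case 1 thus ?thesis using assms(1) by simp
  next
    case 2 thus ?thesis using pos[OF 2 assms] by simp
  next
    case 3
    have "((\<lambda>s. G (- s)) has_vector_derivative - g (- s)) (at s)" for s
    proof -
      have "(G \<circ> uminus has_vector_derivative (-1) *\<^sub>R g (- s)) (at s)"
        by (rule vector_diff_chain_at) (auto intro!: derivative_eq_intros assms(2))
      thus ?thesis by (simp add: o_def)
    qed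
    from pos[of "-t" "\<lambda>s. G (- s)" "\<lambda>s. - g (- s)", OF _ _ this] show ?thesis
      using 3 assms(1) assms(3)[of "- s" for s] by (simp del: power_Suc of_nat_Suc)
  qed
qed

text \<open>Strong continuity alone does not let the argument move with \<open>t\<close>; the
  uniform bound \<open>K\<close> does, through
  \<open>A t (u t) = A t (u t - u s) + A t (u s)\<close>.\<close>

lemma continuous_on_strong_apply:
  fixes A :: "real \<Rightarrow> 'b::real_normed_vector \<Rightarrow> 'b"
  assumes lin: "\<And>t. linear (A t)" and bd: "\<And>t y. norm (A t y) \<le> K * norm y"
    and A: "\<And>y. continuous_on UNIV (\<lambda>t. A t y)" and u: "continuous_on UNIV u"
  shows "continuous_on UNIV (\<lambda>t. A t (u t))"
proof -
  have "((\<lambda>t. A t (u t)) \<longlongrightarrow> A s (u s)) (at s)" for s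
  proof -
    have us: "(u \<longlongrightarrow> u s) (at s)" and As: "((\<lambda>t. A t (u s)) \<longlongrightarrow> A s (u s)) (at s)"
      using u A by (auto simp: continuous_on_def)
    have "((\<lambda>t. A t (u t - u s)) \<longlongrightarrow> 0) (at s)"
    proof (rule Lim_null_comparison)
      show "\<forall>\<^sub>F t in at s. norm (A t (u t - u s)) \<le> K * norm (u t - u s)" using bd by simp
      show "((\<lambda>t. K * norm (u t - u s)) \<longlongrightarrow> 0) (at s)"
        by (intro tendsto_mult_right_zero tendsto_norm_zero LIM_zero us)
    qed
    from tendsto_add[OF this As] show ?thesis
      using linear_diff[OF lin] by simp
  qed
  thus ?thesis by (simp add: continuous_on_def)
qed

text \<open>The Picard (Dyson) series: each \<open>u (Suc n)\<close> is the primitive of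
  \<open>A t (u n t)\<close> vanishing at 0, starting from the constant \<xi>. The factorial bound
  makes the terms and their derivatives converge uniformly on bounded intervals, so the sum may be
  differentiated term by term.\<close>

lemma linear_ode_solution_exists:
  fixes A :: "real \<Rightarrow> 'b::banach \<Rightarrow> 'b"
  assumes lin: "\<And>t. linear (A t)" and bd: "\<And>t y. norm (A t y) \<le> K * norm y" and K: "0 \<le> K"
    and A: "\<And>y. continuous_on UNIV (\<lambda>t. A t y)"
  shows "\<exists>y. y 0 = \<xi> \<and> (\<forall>t. (y has_vector_derivative A t (y t)) (at t))"
proof -
  define P where "P u v \<longleftrightarrow> v 0 = 0 \<and> (\<forall>t. (v has_vector_derivative A t (u t)) (at t))" for u v :: "real \<Rightarrow> 'b"
  define u where "u = rec_nat (\<lambda>_. \<xi>) (\<lambda>_ u. SOME v. P u v)"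
  have P_cont: "continuous_on UNIV v" if "P u v" for u v
    using that by (intro continuous_at_imp_continuous_on ballI)
      (auto simp: P_def intro: has_vector_derivative_continuous)
  have P_ex: "\<exists>v. P u v" if "continuous_on UNIV u" for u
    using antiderivative_real_exists[OF continuous_on_strong_apply[OF lin bd A that]]
    unfolding P_def by metis
  have u_Suc_cont: "P (u n) (u (Suc n)) \<and> continuous_on UNIV (u n)" for n
  proof (induction n)
    case 0
    have "continuous_on UNIV (u 0)" by (simp add: u_def)
    thus ?case using someI_ex[OF P_ex, of "u 0"] by (simp add: u_def)
  next
    case (Suc n)
    hence "continuous_on UNIV (u (Suc n))" using P_cont by blast
    thus ?case using someI_ex[OF P_ex, of "u (Suc n)"] by (simp add: u_def)
  qed
  have u0: "u 0 t = \<xi>" for t by (simp add: u_def)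
  have u_Suc0: "u (Suc n) 0 = 0" and
    u_Suc: "(u (Suc n) has_vector_derivative A t (u n t)) (at t)" for n t
    using u_Suc_cont unfolding P_def by blast+
  have u_bound: "norm (u n t) \<le> norm \<xi> * K ^ n / fact n * \<bar>t\<bar> ^ n" for n t
  proof (induction n arbitrary: t)
    case 0 thus ?case by (simp add: u0)
  next
    case (Suc n)
    have "norm (A t (u n t)) \<le> norm \<xi> * K ^ Suc n / fact n * \<bar>t\<bar> ^ n" for t
      using order_trans[OF bd mult_left_mono[OF Suc[of t] K]] by (simp add: mult_ac)
    from norm_primitive_le[OF u_Suc0 u_Suc this, of t] show ?case
      by (simp add: field_simps)
  qed
  define y where "y t = (\<Sum>n. u n t)" for t
  \<comment> \<open>\<open>c n\<close> is the derivative of \<open>u n\<close>; the shift of index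
    reflects that \<open>u 0\<close> is constant.\<close>
  define c where "c n t = (case n of 0 \<Rightarrow> 0 | Suc m \<Rightarrow> A t (u m t))" for n t
  have u_deriv: "(u n has_vector_derivative c n t) (at t)" for n t
  proof (cases n)
    case 0
    have "u 0 = (\<lambda>_. \<xi>)" by (simp add: u_def)
    thus ?thesis using 0 by (simp add: c_def)
  qed (simp add: c_def u_Suc)
  have summ: "summable (\<lambda>n. norm \<xi> * K ^ n / fact n * R ^ n)" for R
    using summable_mult[OF summable_exp_generic[of "K * R"], of "norm \<xi>"]
    by (simp add: power_mult_distrib field_simps)
  have u_summ: "summable (\<lambda>n. u n t)" for t
    by (rule summable_comparison_test'[OF summ[of "\<bar>t\<bar>"], of 0]) (use u_bound in auto)
  have c_sums: "(\<lambda>n. c n t) sums A t (y t)" for t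
  proof -
    have "bounded_linear (A t)"
      using lin[of t] bd by (intro bounded_linear.intro) (auto simp: bounded_linear_axioms_def mult.commute)
    from bounded_linear.sums[OF this summable_sums[OF u_summ[of t]]]
    have "(\<lambda>n. c (Suc n) t) sums (A t (y t))" by (simp add: c_def y_def)
    thus ?thesis by (subst (asm) sums_Suc_iff) (simp add: c_def)
  qed
  have "(y has_vector_derivative A t (y t)) (at t)" for t
  proof -
    define R where "R = \<bar>t\<bar> + 1"
    have t: "t \<in> ball 0 R" by (simp add: R_def)
    define M where "M n = (case n of 0 \<Rightarrow> 0 | Suc n \<Rightarrow> K * (norm \<xi> * K ^ n / fact n * R ^ n))" for n
    have "summable (\<lambda>n. M (Suc n))" using summable_mult[OF summ, of K] by (simp add: M_def)
    hence M: "summable M" by (subst (asm) summable_Suc_iff)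
    have cM: "norm (c n s) \<le> M n" if "s \<in> ball 0 R" for n s
    proof (cases n)
      case (Suc m)
      have "norm \<xi> * K ^ m / fact m * \<bar>s\<bar> ^ m \<le> norm \<xi> * K ^ m / fact m * R ^ m"
        using that K by (intro mult_left_mono power_mono) auto
      from order_trans[OF bd mult_left_mono[OF order_trans[OF u_bound this] K]]
      show ?thesis by (simp add: Suc c_def M_def)
    qed (simp add: c_def M_def)
    have ul: "uniform_limit (ball 0 R) (\<lambda>n s. \<Sum>i<n. c i s) (\<lambda>s. A s (y s)) sequentially"
      unfolding sums_unique[OF c_sums] by (rule Weierstrass_m_test[OF cM M])
    have "\<exists>g. \<forall>s\<in>ball 0 R. (\<lambda>n. u n s) sums g s \<and>
       (g has_derivative (\<lambda>h. h *\<^sub>R A s (y s))) (at s within ball 0 R)"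
    proof (rule has_derivative_series)
      show "(u n has_derivative (\<lambda>h. h *\<^sub>R c n s)) (at s within ball 0 R)" for n s
        using u_deriv[of n s] unfolding has_vector_derivative_def by (rule has_derivative_at_withinI)
      fix e :: real assume "0 < e"
      from uniform_limitD[OF ul this]
      show "\<forall>\<^sub>F n in sequentially. \<forall>s\<in>ball 0 R. \<forall>h. norm ((\<Sum>i<n. h *\<^sub>R c i s) - h *\<^sub>R A s (y s)) \<le> e * norm h"
      proof eventually_elim
        case (elim n)
        show ?case
        proof (intro ballI allI)
          fix s h :: real assume "s \<in> ball 0 R"
          hence "norm ((\<Sum>i<n. c i s) - A s (y s)) \<le> e" using elim by (auto simp: dist_norm less_imp_le)
          hence "\<bar>h\<bar> * norm ((\<Sum>i<n. c i s) - A s (y s)) \<le> \<bar>h\<bar> * e" by (intro mult_left_mono) auto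
          thus "norm ((\<Sum>i<n. h *\<^sub>R c i s) - h *\<^sub>R A s (y s)) \<le> e * norm h"
            by (simp add: scaleR_sum_right[symmetric] scaleR_diff_right[symmetric] mult.commute)
        qed
      qed
    next
      show "(\<lambda>n. u n t) sums y t" unfolding y_def by (rule summable_sums[OF u_summ])
      show "t \<in> ball 0 R" by (rule t)
    qed simp
    then obtain g where g: "\<And>s. s \<in> ball 0 R \<Longrightarrow> (\<lambda>n. u n s) sums g s"
      "\<And>s. s \<in> ball 0 R \<Longrightarrow> (g has_derivative (\<lambda>h. h *\<^sub>R A s (y s))) (at s within ball 0 R)" by blast
    have "g s = y s" if "s \<in> ball 0 R" for s using sums_unique[OF g(1)[OF that]] by (simp add: y_def)
    moreover have "(g has_vector_derivative A t (y t)) (at t)"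
      using g(2)[OF t] at_within_open[OF t] by (simp add: has_vector_derivative_def)
    ultimately show ?thesis
      using has_vector_derivative_transform_within_open[of g _ t "ball 0 R" y] t by auto
  qed
  moreover have "y 0 = \<xi>"
  proof -
    have "(\<lambda>n. u (Suc n) 0) sums 0" by (simp add: u_Suc0)
    hence "(\<lambda>n. u n 0) sums \<xi>" by (subst (asm) sums_Suc_iff) (simp add: u0)
    thus ?thesis by (simp add: y_def sums_iff)
  qed
  ultimately show ?thesis by blast
qed

subsection \<open>Multiplication operators\<close>

text \<open>Also meant for unbounded \<open>m\<close>: the value is then meaningful only where the
  product is square summable, since \<open>ell2_of\<close> is unspecified elsewhere.
  \<open>coord_mult_l2\<close> serves that case and \<open>coord_mult\<close> the bounded
  one.\<close>

definition dmult :: "'a vec \<Rightarrow> 'a ell2 \<Rightarrow> 'a ell2"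
  where "dmult m f = ell2_of (\<lambda>x. m x * coord f x)"

abbreviation imul :: "'a ell2 \<Rightarrow> 'a ell2"
  where "imul \<equiv> dmult (\<lambda>_. \<i>)"

lemma coord_mult_l2: "(\<lambda>x. m x * coord f x) \<in> l2 \<Longrightarrow> coord (dmult m f) x = m x * coord f x"
  by (simp add: dmult_def)

lemma coord_mult:
  assumes "\<And>x. cmod (m x) \<le> C"
  shows "coord (dmult m f) x = m x * coord f x"
  by (rule coord_mult_l2, rule l2_mono[OF coord, of _ C f])
     (simp add: norm_mult mult_right_mono assms)

lemma coord_imul [simp]: "coord (imul f) x = \<i> * coord f x"
  by (rule coord_mult[where C = 1]) simp

lemma norm_ell2_mono:
  assumes "\<And>x. cmod (coord f x) \<le> C * cmod (coord g x)" "0 \<le> C"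
  shows "norm f \<le> C * norm g"
  unfolding norm_ell2_l2norm using assms by (intro l2norm_mono) auto

lemma norm_mult_le:
  assumes "\<And>x. cmod (m x) \<le> C"
  shows "norm (dmult m f) \<le> C * norm f"
proof (rule norm_ell2_mono)
  show "0 \<le> C" using order_trans[OF norm_ge_zero assms] .
qed (simp add: coord_mult[OF assms] norm_mult mult_right_mono assms)

lemma norm_mult_unimodular:
  assumes "\<And>x. cmod (m x) = 1"
  shows "norm (dmult m f) = norm f"
proof -
  have "coord (dmult m f) x = m x * coord f x" for x
    by (rule coord_mult[where C = 1]) (simp add: assms)
  thus ?thesis
    unfolding norm_ell2_l2norm l2norm_def by (simp add: norm_mult assms)
qed

lemma linear_mult:
  assumes "\<And>x. cmod (m x) \<le> C"
  shows "linear (dmult m)"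
  by (rule linearI) (auto intro!: ell2_eqI simp: coord_mult[OF assms] algebra_simps)

lemma bounded_linear_mult:
  assumes "\<And>x. cmod (m x) \<le> C"
  shows "bounded_linear (dmult m)"
  using linear_mult[of m, OF assms] norm_mult_le[of m, OF assms]
  by (intro bounded_linear.intro) (auto simp: bounded_linear_axioms_def mult.commute)

lemma bounded_linear_imul: "bounded_linear imul"
  by (rule bounded_linear_mult[where C = 1]) simp

lemma norm_imul [simp]: "norm (imul f) = norm f"
  by (rule norm_mult_unimodular) simp

lemma imul_imul [simp]: "imul (imul f) = - f"
  by (rule ell2_eqI) simp

lemma imul_mult_commute:
  assumes "\<And>x. cmod (m x) \<le> C"
  shows "imul (dmult m f) = dmult m (imul f)"
  by (rule ell2_eqI) (simp add: coord_mult[OF assms])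

lemma inner_mult:
  assumes "\<And>x. cmod (m x) \<le> C"
  shows "inner (dmult m f) g = inner f (dmult (\<lambda>x. cnj (m x)) g)"
proof -
  have "coord (dmult (\<lambda>x. cnj (m x)) g) x = cnj (m x) * coord g x" for x
    by (rule coord_mult[where C = C]) (simp add: assms)
  thus ?thesis unfolding inner_ell2_def
    by (intro infsum_cong) (simp add: coord_mult[of m, OF assms] algebra_simps)
qed

lemma inner_imul: "inner (imul f) g = - inner f (imul g)"
proof -
  have "inner (imul f) g = inner f (dmult (\<lambda>x. - \<i>) g)"
    by (subst inner_mult[where C = 1]) auto
  also have "dmult (\<lambda>x. - \<i>) g = - imul g"
    by (rule ell2_eqI) (simp add: coord_mult[where C = 1])
  finally show ?thesis by simp
qed

subsection \<open>Finitely supported vectors and dominated convergence\<close>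

abbreviation restr :: "'a set \<Rightarrow> 'a ell2 \<Rightarrow> 'a ell2"
  where "restr S \<equiv> dmult (\<lambda>x. if x \<in> S then 1 else 0)"

lemma coord_restr [simp]: "coord (restr S f) x = (if x \<in> S then coord f x else 0)"
  by (subst coord_mult[where C = 1]) auto

lemma norm_restr_le: "norm (restr S f) \<le> norm f"
  using norm_mult_le[of "\<lambda>x. if x \<in> S then 1 else 0" 1 f] by auto

lemma norm_restr_square:
  assumes "finite S"
  shows "(norm (restr S f))\<^sup>2 = (\<Sum>x\<in>S. (cmod (coord f x))\<^sup>2)"
proof -
  have "(norm (restr S f))\<^sup>2 = infsum (\<lambda>x. (cmod (coord (restr S f) x))\<^sup>2) UNIV"
    unfolding norm_ell2_l2norm l2norm_square ..
  also have "\<dots> = infsum (\<lambda>x. (cmod (coord f x))\<^sup>2) S"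
    by (rule infsum_cong_neutral) auto
  finally show ?thesis using assms by simp
qed

lemma norm_restr_le_sum:
  assumes "finite S"
  shows "norm (restr S f) \<le> (\<Sum>x\<in>S. cmod (coord f x))"
proof -
  have "norm (restr S f) = L2_set (\<lambda>x. cmod (coord f x)) S"
    unfolding L2_set_def norm_restr_square[OF assms, symmetric] by simp
  thus ?thesis by (simp add: L2_set_le_sum)
qed

lemma coord_restr_in_c00: "finite S \<Longrightarrow> coord (restr S f) \<in> c00"
  by (auto simp: c00_def intro: finite_subset[of _ S])

lemma ell2_tail:
  assumes "0 < e"
  obtains S where "finite S" "norm (f - restr S f) \<le> e"
proof -
  have sm: "(\<lambda>x. (cmod (coord f x))\<^sup>2) summable_on UNIV"
    using coord[of f] by (simp add: l2_def)
  obtain S where S: "finite S"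
      "dist (\<Sum>x\<in>S. (cmod (coord f x))\<^sup>2) (infsum (\<lambda>x. (cmod (coord f x))\<^sup>2) UNIV) \<le> e\<^sup>2"
    using infsum_finite_approximation[OF sm, of "e\<^sup>2"] assms by auto
  have orth: "inner (restr S f) (f - restr S f) = 0"
    unfolding inner_ell2_def by (rule infsum_0) simp
  have "(norm (restr S f + (f - restr S f)))\<^sup>2 = (norm (restr S f))\<^sup>2 + (norm (f - restr S f))\<^sup>2"
    unfolding power2_norm_eq_inner inner_add_left inner_add_right
    by (simp only: orth inner_commute[of "f - restr S f" "restr S f"] add_0_left add_0_right)
  hence "(norm (f - restr S f))\<^sup>2 = (norm f)\<^sup>2 - (norm (restr S f))\<^sup>2" by simp
  also have "\<dots> \<le> e\<^sup>2"
    unfolding norm_restr_square[OF S(1)]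
    using S(2) unfolding norm_ell2_l2norm l2norm_square
    by (simp add: dist_real_def abs_le_iff)
  finally have "norm (f - restr S f) \<le> e" using assms by (auto intro: power2_le_imp_le)
  thus thesis using that S(1) by blast
qed

lemma closure_finitely_supported: "closure {f. coord f \<in> c00} = UNIV"
proof -
  have "f \<in> closure {f. coord f \<in> c00}" for f :: "'a ell2"
    unfolding closure_approachable
  proof (intro allI impI)
    fix e :: real assume "0 < e"
    then obtain S where "finite S" "norm (f - restr S f) \<le> e / 2" using ell2_tail[of "e/2"] by auto
    thus "\<exists>y\<in>{f. coord f \<in> c00}. dist y f < e"
      using \<open>0 < e\<close> by (intro bexI[of _ "restr S f"]) (auto simp: dist_norm norm_minus_commute coord_restr_in_c00)
  qed
  thus ?thesis by auto
qed

lemma norm_le_on_dense: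
  fixes A :: "'a::real_normed_vector \<Rightarrow> 'b::real_normed_vector"
  assumes "bounded_linear A" "closure X = UNIV" "\<And>x. x \<in> X \<Longrightarrow> norm (A x) \<le> c * norm x"
  shows "norm (A x) \<le> c * norm x"
proof -
  have "closure X \<subseteq> {x. norm (A x) \<le> c * norm x}"
    using assms(3) by (intro closure_minimal closed_Collect_le continuous_intros
       linear_continuous_on[OF assms(1)] bounded_linear.continuous_on[OF assms(1)]) auto
  thus ?thesis using assms(2) by auto
qed

text \<open>A finite set \<open>S\<close> carries all but \<open>e / 2\<close> of the norm of the
  majorant. Off \<open>S\<close> the vectors are dominated by that tail, and on \<open>S\<close>
  only finitely many coordinates have to tend to 0.\<close>

lemma ell2_dominated_convergence:
  fixes G :: "'t \<Rightarrow> 'a ell2"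
  assumes lim: "\<And>x. ((\<lambda>t. coord (G t) x) \<longlongrightarrow> 0) F"
    and dom: "\<forall>\<^sub>F t in F. \<forall>x. cmod (coord (G t) x) \<le> cmod (coord g x)"
  shows "(G \<longlongrightarrow> 0) F"
proof (rule tendstoI)
  fix e :: real assume e: "0 < e"
  then obtain S where S: "finite S" "norm (g - restr S g) \<le> e / 2" using ell2_tail[of "e/2"] by auto
  have "((\<lambda>t. \<Sum>x\<in>S. cmod (coord (G t) x)) \<longlongrightarrow> (\<Sum>x\<in>S. 0)) F"
    by (intro tendsto_sum tendsto_norm_zero lim)
  hence "\<forall>\<^sub>F t in F. (\<Sum>x\<in>S. cmod (coord (G t) x)) < e / 2"
    using e by (intro order_tendstoD(2)) auto
  with dom show "\<forall>\<^sub>F t in F. dist (G t) 0 < e"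
  proof eventually_elim
    case (elim t)
    have "norm (G t - restr S (G t)) \<le> 1 * norm (g - restr S g)"
      using elim(1) by (intro norm_ell2_mono) auto
    moreover have "norm (restr S (G t)) < e / 2"
      using norm_restr_le_sum[OF S(1), of "G t"] elim(2) by simp
    ultimately show ?case
      using S(2) norm_triangle_ineq[of "G t - restr S (G t)" "restr S (G t)"] by (simp add: dist_norm)
  qed
qed

subsection \<open>The unitary group of a real diagonal operator\<close>

definition phase :: "('a \<Rightarrow> real) \<Rightarrow> real \<Rightarrow> 'a ell2 \<Rightarrow> 'a ell2"
  where "phase d t = dmult (\<lambda>x. cis (t * d x))"

lemma coord_phase [simp]: "coord (phase d t f) x = cis (t * d x) * coord f x"
  unfolding phase_def
  by (rule coord_mult[where C = 1]) simp

lemma bounded_linear_phase: "bounded_linear (phase d t)"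
  unfolding phase_def
  by (rule bounded_linear_mult[where C = 1]) simp

lemma norm_phase [simp]: "norm (phase d t f) = norm f"
  unfolding phase_def
  by (rule norm_mult_unimodular) simp

lemma phase_0 [simp]: "phase d 0 f = f"
  by (rule ell2_eqI) simp

lemma phase_add: "phase d (s + t) f = phase d s (phase d t f)"
  by (rule ell2_eqI) (simp add: cis_mult[symmetric] algebra_simps)

lemma phase_minus [simp]: "phase d (- t) (phase d t f) = f" "phase d t (phase d (- t) f) = f"
  by (rule ell2_eqI; simp add: cis_mult mult.assoc[symmetric])+

lemma imul_phase: "imul (phase d t f) = phase d t (imul f)"
  unfolding phase_def
  by (rule imul_mult_commute[where C = 1]) simp

lemma inner_phase: "inner (phase d t f) g = inner f (phase d (- t) g)"
  unfolding phase_def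
  by (subst inner_mult[where C = 1]) (auto simp: cis_cnj)

lemma phase_tendsto_0: "((\<lambda>t. phase d t f) \<longlongrightarrow> f) (at 0)"
proof -
  have "((\<lambda>t. phase d t f - f) \<longlongrightarrow> 0) (at 0)"
  proof (rule ell2_dominated_convergence[where g = "2 *\<^sub>R f"])
    fix x
    have "((\<lambda>t. cis (t * d x) * coord f x - coord f x) \<longlongrightarrow> cis (0 * d x) * coord f x - coord f x) (at 0)"
      unfolding cis_conv_exp by (intro tendsto_intros)
    thus "((\<lambda>t. coord (phase d t f - f) x) \<longlongrightarrow> 0) (at 0)" by simp
  next
    have "cmod (cis (t * d x) * coord f x - coord f x) \<le> 2 * cmod (coord f x)" for t x
      using norm_triangle_ineq4[of "cis (t * d x) * coord f x" "coord f x"] by (simp add: norm_mult)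
    thus "\<forall>\<^sub>F t in at 0. \<forall>x. cmod (coord (phase d t f - f) x) \<le> cmod (coord (2 *\<^sub>R f) x)"
      by (simp add: norm_mult)
  qed
  thus ?thesis by (rule LIM_zero_cancel)
qed

lemma continuous_on_phase: "continuous_on UNIV (\<lambda>t. phase d t f)"
proof -
  have "((\<lambda>t. phase d t f) \<longlongrightarrow> phase d s f) (at s)" for s
  proof -
    have "((\<lambda>h. phase d s (phase d h f)) \<longlongrightarrow> phase d s f) (at 0)"
      by (rule bounded_linear.tendsto[OF bounded_linear_phase phase_tendsto_0])
    thus ?thesis by (intro LIM_offset_zero_cancel[where a = s]) (simp add: phase_add)
  qed
  thus ?thesis by (simp add: continuous_on_def)
qed

lemma cmod_cis_minus_one_le: "cmod (cis a - 1) \<le> \<bar>a\<bar>"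
  using dist_exp_i_1[of a] abs_sin_le_one abs_sin_x_le_abs_x[of "a / 2"]
  by (simp add: dist_norm cis_conv_exp)

lemma cis_difference_quotient: "((\<lambda>t. (cis (t * a) - 1) / of_real t) \<longlongrightarrow> \<i> * of_real a) (at 0)"
proof -
  have "((\<lambda>z. exp (\<i> * (z * of_real a))) has_field_derivative \<i> * of_real a) (at 0)"
    by (auto intro!: derivative_eq_intros)
  hence "((\<lambda>z. (exp (\<i> * (z * of_real a)) - 1) / z) \<longlongrightarrow> \<i> * of_real a) (at 0)"
    by (simp add: has_field_derivative_iff)
  moreover have "filterlim (complex_of_real) (at 0) (at 0)"
    by (auto simp: filterlim_at eventually_at_filter intro!: tendsto_eq_intros)
  ultimately have "((\<lambda>t. (exp (\<i> * (of_real t * of_real a)) - 1) / of_real t) \<longlongrightarrow> \<i> * of_real a) (at 0)"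
    by (rule filterlim_compose)
  thus ?thesis by (simp add: cis_conv_exp)
qed

lemma coord_phase_quotient:
  "coord ((1 / t) *\<^sub>R (phase d t f - f)) x = (cis (t * d x) - 1) / of_real t * coord f x"
  by (simp add: divide_inverse algebra_simps)

text \<open>Dominated convergence with majorant twice \<bar>d f\<bar>: the quotient is at most
  \<bar>d f\<bar> because \<bar>cis a - 1\<bar> \<le> \<bar>a\<bar>, and its limit has that same
  size.\<close>

lemma phase_difference_quotient:
  assumes "(\<lambda>x. of_real (d x) * coord f x) \<in> l2"
  shows "((\<lambda>t. (1 / t) *\<^sub>R (phase d t f - f)) \<longlongrightarrow> imul (dmult (\<lambda>x. of_real (d x)) f)) (at 0)"
proof -
  let ?g = "dmult (\<lambda>x. of_real (d x)) f"
  have g: "coord ?g x = of_real (d x) * coord f x" for x by (rule coord_mult_l2[OF assms])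
  have "((\<lambda>t. (1 / t) *\<^sub>R (phase d t f - f) - imul ?g) \<longlongrightarrow> 0) (at 0)"
  proof (rule ell2_dominated_convergence[where g = "2 *\<^sub>R ?g"])
    fix x
    have "((\<lambda>t. (cis (t * d x) - 1) / of_real t * coord f x - \<i> * of_real (d x) * coord f x) \<longlongrightarrow> 
       \<i> * of_real (d x) * coord f x - \<i> * of_real (d x) * coord f x) (at 0)"
      by (intro tendsto_intros cis_difference_quotient)
    thus "((\<lambda>t. coord ((1 / t) *\<^sub>R (phase d t f - f) - imul ?g) x) \<longlongrightarrow> 0) (at 0)"
      by (simp only: coord_diff coord_phase_quotient coord_imul g mult.assoc) simp
  next
    have "cmod (coord ((1 / t) *\<^sub>R (phase d t f - f) - imul ?g) x) \<le> cmod (coord (2 *\<^sub>R ?g) x)"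
      if t: "t \<noteq> 0" for t x
    proof -
      have "cmod (cis (t * d x) - 1) / \<bar>t\<bar> \<le> \<bar>d x\<bar>"
        using cmod_cis_minus_one_le[of "t * d x"] t by (simp add: abs_mult field_simps)
      hence "cmod ((cis (t * d x) - 1) / of_real t - \<i> * of_real (d x)) \<le> 2 * \<bar>d x\<bar>"
        using norm_triangle_ineq4[of "(cis (t * d x) - 1) / of_real t" "\<i> * of_real (d x)"]
        by (simp add: norm_mult norm_divide)
      hence "cmod ((cis (t * d x) - 1) / of_real t - \<i> * of_real (d x)) * cmod (coord f x) \<le> 2 * \<bar>d x\<bar> * cmod (coord f x)"
        by (rule mult_right_mono) simp
      moreover have "coord ((1 / t) *\<^sub>R (phase d t f - f) - imul ?g) x =
          ((cis (t * d x) - 1) / of_real t - \<i> * of_real (d x)) * coord f x"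
        by (simp only: coord_diff coord_phase_quotient coord_imul g left_diff_distrib mult.assoc)
      ultimately show ?thesis by (simp add: g norm_mult)
    qed
    thus "\<forall>\<^sub>F t in at 0. \<forall>x. cmod (coord ((1 / t) *\<^sub>R (phase d t f - f) - imul ?g) x) \<le> cmod (coord (2 *\<^sub>R ?g) x)"
      by (auto simp: eventually_at_filter)
  qed
  thus ?thesis by (rule LIM_zero_cancel)
qed

text \<open>Norm convergence implies convergence of each coordinate, which identifies
  \<open>coord g x\<close> with \<open>\<i> * of_real (d x) * coord f x\<close>. Thus d f is -\<i>
  g, and the generator of the group has no larger domain than d.\<close>

lemma phase_differentiable_imp:
  assumes "((\<lambda>t. (1 / t) *\<^sub>R (phase d t f - f)) \<longlongrightarrow> g) (at 0)"
  shows "(\<lambda>x. of_real (d x) * coord f x) \<in> l2"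
proof -
  have "of_real (d x) * coord f x = - \<i> * coord g x" for x
  proof -
    have "((\<lambda>t. (cis (t * d x) - 1) / of_real t * coord f x) \<longlongrightarrow> \<i> * of_real (d x) * coord f x) (at 0)"
      by (intro tendsto_intros cis_difference_quotient)
    moreover have "((\<lambda>t. (cis (t * d x) - 1) / of_real t * coord f x) \<longlongrightarrow> coord g x) (at 0)"
      using bounded_linear.tendsto[OF bounded_linear_coord assms, of x]
      by (simp only: coord_phase_quotient)
    ultimately have "\<i> * of_real (d x) * coord f x = coord g x"
      by (rule tendsto_unique[OF at_neq_bot])
    thus ?thesis by (auto simp: complex_eq_iff)
  qed
  thus ?thesis using l2_cmult[OF coord[of g], of "- \<i>"] by simp
qed

subsection \<open>Unitary groups generated by bounded perturbations of diagonal operators\<close>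

lemma has_vector_derivative_iff_quotient:
  fixes f :: "real \<Rightarrow> 'b::real_normed_vector"
  shows "(f has_vector_derivative D) (at x) \<longleftrightarrow> ((\<lambda>h. (1 / h) *\<^sub>R (f (x + h) - f x)) \<longlongrightarrow> D) (at 0)"
proof -
  have "norm (f (x + h) - f x - h *\<^sub>R D) / norm h = norm ((1 / h) *\<^sub>R (f (x + h) - f x) - D)"
    if "h \<noteq> 0" for h
  proof -
    have "(1 / h) *\<^sub>R (f (x + h) - f x) - D = (1 / h) *\<^sub>R (f (x + h) - f x - h *\<^sub>R D)"
      using that by (simp add: scaleR_diff_right)
    thus ?thesis by (simp add: divide_inverse mult.commute)
  qed
  hence "((\<lambda>h. norm (f (x + h) - f x - h *\<^sub>R D) / norm h) \<longlongrightarrow> 0) (at 0) \<longleftrightarrow>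
      ((\<lambda>h. norm ((1 / h) *\<^sub>R (f (x + h) - f x) - D)) \<longlongrightarrow> 0) (at 0)"
    by (intro filterlim_cong) (auto simp: eventually_at_filter)
  thus ?thesis
    unfolding has_vector_derivative_def has_derivative_at tendsto_norm_zero_iff LIM_zero_iff
    by (simp add: bounded_linear_scaleR_left)
qed

lemma norm_constant_of_orthogonal_derivative:
  fixes y :: "real \<Rightarrow> 'b::real_inner"
  assumes "\<And>t. (y has_vector_derivative y' t) (at t)" "\<And>t. inner (y' t) (y t) = 0"
  shows "norm (y t) = norm (y 0)"
proof -
  have "((\<lambda>t. inner (y t) (y t)) has_real_derivative 0) (at t)" for t
    using bounded_bilinear.has_vector_derivative[OF bounded_bilinear_inner assms(1)[of t] assms(1)[of t]] assms(2)[of t]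
    by (simp add: has_real_derivative_iff_has_vector_derivative inner_commute)
  hence "inner (y t) (y t) = inner (y 0) (y 0)" by (intro DERIV_isconst_all) auto
  thus ?thesis by (simp add: norm_eq_sqrt_inner)
qed

text \<open>A bounded real-linear map commuting with \<open>imul\<close> is complex linear, and
  symmetry for the real inner product then makes it self-adjoint on the complex space.\<close>

locale diagonal_perturbation =
  fixes d :: "'a \<Rightarrow> real" and B :: "'a ell2 \<Rightarrow> 'a ell2"
  assumes bounded_linear_B: "bounded_linear B"
    and B_imul: "B (imul f) = imul (B f)"
    and B_symmetric: "inner (B f) g = inner f (B g)"
begin

definition dom :: "'a ell2 set"
  where "dom = {f. (\<lambda>x. of_real (d x) * coord f x) \<in> l2}"

definition H :: "'a ell2 \<Rightarrow> 'a ell2"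
  where "H f = dmult (\<lambda>x. of_real (d x)) f + B f"

text \<open>The counterpart of \<open>generated_group\<close> on \<open>ell2\<close>. Complex
  linearity is split into \<open>linear\<close> and commutation with \<open>imul\<close>;
  surjectivity of \<open>U t\<close> is contained in the group law, with inverse
  \<open>U (- t)\<close>.\<close>

definition unitary_group_of :: "(real \<Rightarrow> 'a ell2 \<Rightarrow> 'a ell2) \<Rightarrow> bool"
  where "unitary_group_of U \<longleftrightarrow>
    (\<forall>t. linear (U t)) \<and> (\<forall>t f. U t (imul f) = imul (U t f)) \<and> (\<forall>t f. norm (U t f) = norm f) \<and>
    (\<forall>f. U 0 f = f) \<and> (\<forall>s t f. U (s + t) f = U s (U t f)) \<and> (\<forall>f. continuous_on UNIV (\<lambda>t. U t f)) \<and>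
    (\<forall>f. f \<in> dom \<longleftrightarrow> (\<exists>g. ((\<lambda>t. (1 / t) *\<^sub>R (U t f - f)) \<longlongrightarrow> g) (at 0))) \<and>
    (\<forall>f\<in>dom. ((\<lambda>t. (1 / t) *\<^sub>R (U t f - f)) \<longlongrightarrow> imul (H f)) (at 0))"

text \<open>The coefficient of the interaction picture: substituting exp(ith) = exp(itd) V(t) in the
  evolution equation cancels d and leaves this bounded operator.\<close>

definition A :: "real \<Rightarrow> 'a ell2 \<Rightarrow> 'a ell2"
  where "A t f = imul (phase d (- t) (B (phase d t f)))"

lemma bounded_linear_A: "bounded_linear (A t)"
  unfolding A_def
  by (intro bounded_linear_compose[OF bounded_linear_imul] bounded_linear_compose[OF bounded_linear_B]
      bounded_linear_compose[OF bounded_linear_phase] bounded_linear_phase)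

lemma A_bounded: obtains K where "0 \<le> K" "\<And>t f. norm (A t f) \<le> K * norm f"
proof -
  obtain K where "0 < K" "\<And>f. norm (B f) \<le> norm f * K"
    using bounded_linear.pos_bounded[OF bounded_linear_B] by blast
  hence "norm (A t f) \<le> norm (phase d t f) * K" for t f
    unfolding A_def norm_imul norm_phase[of d "- t"] by blast
  hence "norm (A t f) \<le> K * norm f" for t f
    by (simp add: mult.commute[of K])
  thus thesis using that \<open>0 < K\<close> less_imp_le by blast
qed

lemma continuous_on_A: "continuous_on UNIV (\<lambda>t. A t f)"
proof -
  have 1: "continuous_on UNIV (\<lambda>t. B (phase d t f))"
    by (rule bounded_linear.continuous_on[OF bounded_linear_B continuous_on_phase])
  have 2: "continuous_on UNIV (\<lambda>t. phase d (- t) g)" for g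
    by (rule continuous_on_compose2[OF continuous_on_phase[of d g]]) (auto intro: continuous_intros)
  have "continuous_on UNIV (\<lambda>t. phase d (- t) (B (phase d t f)))"
    by (rule continuous_on_strong_apply[where K = 1, OF _ _ 2 1])
      (auto simp: bounded_linear.linear bounded_linear_phase)
  thus ?thesis unfolding A_def by (rule bounded_linear.continuous_on[OF bounded_linear_imul])
qed

text \<open>\<open>A t\<close> is \<open>imul\<close> composed with a symmetric operator that
  commutes with it, hence skew, and the pairing equals its own negative. Solutions therefore have
  constant norm, which gives both isometry and uniqueness.\<close>

lemma inner_A_self: "inner (A t f) f = 0"
proof -
  define g where "g = phase d t f"
  have "inner (A t f) f = inner (imul (B g)) g"
    unfolding A_def imul_phase g_def by (simp add: inner_phase)
  also have "\<dots> = - inner (B g) (imul g)" by (rule inner_imul)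
  also have "\<dots> = - inner g (imul (B g))" by (simp add: B_symmetric B_imul)
  also have "\<dots> = - inner (imul (B g)) g" by (simp add: inner_commute)
  finally have "inner (A t f) f = - inner (A t f) f"
    unfolding A_def imul_phase g_def by (simp add: inner_phase)
  thus ?thesis by simp
qed

section \<open>Solutions of the interaction equation and the group built from them\<close>

definition solves :: "(real \<Rightarrow> 'a ell2) \<Rightarrow> bool"
  where "solves y \<longleftrightarrow> (\<forall>t. (y has_vector_derivative A t (y t)) (at t))"

lemma norm_solution: "solves y \<Longrightarrow> norm (y t) = norm (y 0)"
  by (rule norm_constant_of_orthogonal_derivative[of y "\<lambda>t. A t (y t)"]) (auto simp: solves_def inner_A_self)

lemma solves_diff: "solves y \<Longrightarrow> solves z \<Longrightarrow> solves (\<lambda>t. y t - z t)"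
  unfolding solves_def
  by (auto intro!: derivative_eq_intros simp: linear_diff[OF bounded_linear.linear[OF bounded_linear_A]])

lemma solution_unique:
  assumes "solves y" "solves z" "y 0 = z 0"
  shows "y t = z t"
  using norm_solution[OF solves_diff[OF assms(1,2)], of t] assms(3) by simp

definition V :: "'a ell2 \<Rightarrow> real \<Rightarrow> 'a ell2"
  where "V f = (SOME y. y 0 = f \<and> solves y)"

lemma V: "V f 0 = f" "solves (V f)"
proof -
  obtain K where K: "0 \<le> K" "\<And>t f. norm (A t f) \<le> K * norm f" using A_bounded by blast
  have "\<exists>y. y 0 = f \<and> solves y"
    unfolding solves_def
    by (rule linear_ode_solution_exists[OF bounded_linear.linear[OF bounded_linear_A] K(2,1) continuous_on_A])
  hence "V f 0 = f \<and> solves (V f)" unfolding V_def by (rule someI_ex)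
  thus "V f 0 = f" "solves (V f)" by auto
qed

text \<open>The tool for all algebraic properties of \<open>V\<close>: additivity, commutation with
  scalars and \<open>imul\<close>, and the group law of \<open>U\<close> are each proved by
  exhibiting a solution with the right value at 0.\<close>

lemma V_eqI: "solves y \<Longrightarrow> V (y 0) t = y t"
  using solution_unique[OF V(2)] V(1) by blast

lemma norm_V: "norm (V f t) = norm f"
  using norm_solution[OF V(2)] V(1) by simp

lemma V_add: "V (f + g) t = V f t + V g t"
proof -
  have "solves (\<lambda>t. V f t + V g t)"
    using V(2) unfolding solves_def
    by (auto intro!: derivative_eq_intros simp: linear_add[OF bounded_linear.linear[OF bounded_linear_A]])
  from V_eqI[OF this] show ?thesis by (simp add: V(1))
qed

lemma V_comm:
  assumes L: "bounded_linear L" "\<And>t f. A t (L f) = L (A t f)"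
  shows "V (L f) t = L (V f t)"
proof -
  have "solves (\<lambda>t. L (V f t))"
    using V(2)[of f] unfolding solves_def L(2) by (auto intro: bounded_linear.has_vector_derivative[OF L(1)])
  from V_eqI[OF this] show ?thesis by (simp add: V(1))
qed

lemma V_deriv: "(V f has_vector_derivative A t (V f t)) (at t)"
  using V(2) by (simp add: solves_def)

definition U :: "real \<Rightarrow> 'a ell2 \<Rightarrow> 'a ell2"
  where "U t f = phase d t (V f t)"

text \<open>The equation for \<open>V\<close> is not autonomous, but a shift of time by
  \<open>t\<close> only conjugates its coefficient by \<open>phase d t\<close>. So
  \<open>phase d t (V f (r + t))\<close>, as a function of \<open>r\<close>, solves the original
  equation, with initial value \<open>U t f\<close>.\<close>

lemma U_add: "U (s + t) f = U s (U t f)"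
proof -
  have A_shift: "phase d t (A (r + t) g) = A r (phase d t g)" for r g
  proof -
    have "phase d (- (r + t)) h = phase d (- t) (phase d (- r) h)" for h
      by (simp add: phase_add[symmetric] add.commute)
    thus ?thesis unfolding A_def imul_phase[symmetric] by (simp add: phase_add)
  qed
  have "solves (\<lambda>r. phase d t (V f (r + t)))"
    unfolding solves_def
  proof
    fix r
    have "((\<lambda>r. V f (r + t)) has_vector_derivative A (r + t) (V f (r + t))) (at r)"
    proof -
      have "((\<lambda>r. r + t) has_vector_derivative 1) (at r)"
        by (auto intro!: derivative_eq_intros)
      from vector_diff_chain_at[OF this V_deriv[of f "r + t"]] show ?thesis by (simp add: o_def)
    qed
    from bounded_linear.has_vector_derivative[OF bounded_linear_phase[of d t] this]
    show "((\<lambda>r. phase d t (V f (r + t))) has_vector_derivative A r (phase d t (V f (r + t)))) (at r)"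
      by (simp add: A_shift)
  qed
  from V_eqI[OF this, of s] show ?thesis by (simp add: U_def phase_add)
qed

text \<open>Valid for every \<open>f\<close>, in \<open>dom\<close> or not, because \<open>B\<close>
  is bounded. Hence the quotients of \<open>U\<close> and of \<open>phase d\<close> converge for the
  same vectors, which yields the domain of the generator as well as its form.\<close>

lemma U_quotient:
  "((\<lambda>t. (1 / t) *\<^sub>R (U t f - f) - (1 / t) *\<^sub>R (phase d t f - f)) \<longlongrightarrow> imul (B f)) (at 0)"
proof -
  let ?q = "\<lambda>t. (1 / t) *\<^sub>R (V f t - f)" and ?L = "imul (B f)"
  have "A 0 f = ?L" by (simp add: A_def)
  hence q: "(?q \<longlongrightarrow> ?L) (at 0)"
    using V_deriv[of f 0] unfolding has_vector_derivative_iff_quotient by (simp add: V(1))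
  have "((\<lambda>t. phase d t (?q t - ?L)) \<longlongrightarrow> 0) (at 0)"
    by (rule tendsto_norm_zero_cancel) (simp add: tendsto_norm_zero LIM_zero[OF q])
  from tendsto_add[OF this phase_tendsto_0[of d ?L]]
  have "((\<lambda>t. phase d t (?q t)) \<longlongrightarrow> ?L) (at 0)"
    by (simp add: linear_diff[OF bounded_linear.linear[OF bounded_linear_phase]])
  moreover have "(1 / t) *\<^sub>R (U t f - f) - (1 / t) *\<^sub>R (phase d t f - f) = phase d t (?q t)" for t
    by (simp add: U_def linear_scale[OF bounded_linear.linear[OF bounded_linear_phase]]
        linear_diff[OF bounded_linear.linear[OF bounded_linear_phase]] algebra_simps)
  ultimately show ?thesis by simp
qed

lemma unitary_group_of_U: "unitary_group_of U"
  unfolding unitary_group_of_def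
proof (intro conjI allI ballI)
  have imul_lin: "A t (imul f) = imul (A t f)" for t f
    by (simp add: A_def imul_phase[symmetric] B_imul del: imul_imul)
  have scale: "A t (c *\<^sub>R f) = c *\<^sub>R A t f" for t c f
    by (rule linear_scale[OF bounded_linear.linear[OF bounded_linear_A]])
  show "linear (U t)" for t
  proof (rule linearI)
    show "U t (f + g) = U t f + U t g" for f g
      by (simp add: U_def V_add linear_add[OF bounded_linear.linear[OF bounded_linear_phase]])
    show "U t (c *\<^sub>R f) = c *\<^sub>R U t f" for c f
      by (simp add: U_def V_comm[OF bounded_linear_scaleR_right scale] linear_scale[OF bounded_linear.linear[OF bounded_linear_phase]])
  qed
  show "U t (imul f) = imul (U t f)" for t f
    by (simp add: U_def V_comm[OF bounded_linear_imul imul_lin] imul_phase)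
  show "norm (U t f) = norm f" for t f by (simp add: U_def norm_V)
  show "U 0 f = f" for f by (simp add: U_def V(1))
  show "U (s + t) f = U s (U t f)" for s t f by (rule U_add)
  show "continuous_on UNIV (\<lambda>t. U t f)" for f
    unfolding U_def
  proof (rule continuous_on_strong_apply[where A = "phase d" and u = "V f" and K = 1])
    show "continuous_on UNIV (V f)"
      using V_deriv by (intro continuous_at_imp_continuous_on ballI) (rule has_vector_derivative_continuous)
  qed (auto simp: bounded_linear.linear bounded_linear_phase continuous_on_phase)
  show lim: "((\<lambda>t. (1 / t) *\<^sub>R (U t f - f)) \<longlongrightarrow> imul (H f)) (at 0)" if "f \<in> dom" for f
  proof -
    have "((\<lambda>t. (1 / t) *\<^sub>R (phase d t f - f)) \<longlongrightarrow> imul (dmult (\<lambda>x. of_real (d x)) f)) (at 0)"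
      using that by (intro phase_difference_quotient) (simp add: dom_def)
    from tendsto_add[OF U_quotient[of f] this] show ?thesis
      by (simp add: H_def linear_add[OF bounded_linear.linear[OF bounded_linear_imul]] add.commute[of "imul (B f)"])
  qed
  show "f \<in> dom \<longleftrightarrow> (\<exists>g. ((\<lambda>t. (1 / t) *\<^sub>R (U t f - f)) \<longlongrightarrow> g) (at 0))" for f
  proof
    assume "\<exists>g. ((\<lambda>t. (1 / t) *\<^sub>R (U t f - f)) \<longlongrightarrow> g) (at 0)"
    then obtain g where "((\<lambda>t. (1 / t) *\<^sub>R (U t f - f)) \<longlongrightarrow> g) (at 0)" by blast
    from tendsto_diff[OF this U_quotient[of f]]
    have "((\<lambda>t. (1 / t) *\<^sub>R (phase d t f - f)) \<longlongrightarrow> g - imul (B f)) (at 0)" by simp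
    thus "f \<in> dom" unfolding dom_def mem_Collect_eq by (rule phase_differentiable_imp)
  qed (use lim in blast)
qed

subsection \<open>Commutators of the group with multiplication operators\<close>

lemma H_symmetric:
  assumes "f \<in> dom" "g \<in> dom"
  shows "inner (H f) g = inner f (H g)"
proof -
  have "coord (dmult (\<lambda>x. of_real (d x)) h) x = of_real (d x) * coord h x" if "h \<in> dom" for h x
    using that by (intro coord_mult_l2) (simp add: dom_def)
  hence "inner (dmult (\<lambda>x. of_real (d x)) f) g = inner f (dmult (\<lambda>x. of_real (d x)) g)"
    unfolding inner_ell2_def using assms by (intro infsum_cong) (simp add: algebra_simps)
  thus ?thesis by (simp add: H_def inner_add_left inner_add_right B_symmetric)
qed

text \<open>Multiplication operators commute, so d cancels from the commutator of \<open>H\<close>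
  with \<open>dmult m\<close>, and only the bounded part \<open>B\<close> contributes.\<close>

lemma dom_dmult:
  assumes "f \<in> dom" "\<And>x. cmod (m x) \<le> C"
  shows "dmult m f \<in> dom" "dmult m (H f) - H (dmult m f) = dmult m (B f) - B (dmult m f)"
proof -
  note cm = coord_mult[of m, OF assms(2)]
  have f: "(\<lambda>x. of_real (d x) * coord f x) \<in> l2" using assms(1) by (simp add: dom_def)
  show dm: "dmult m f \<in> dom"
    unfolding dom_def mem_Collect_eq cm
  proof (rule l2_mono[OF f, where C = C])
    fix x
    have "cmod (m x) * cmod (of_real (d x) * coord f x) \<le> C * cmod (of_real (d x) * coord f x)"
      by (intro mult_right_mono assms(2)) auto
    thus "cmod (of_real (d x) * (m x * coord f x)) \<le> C * cmod (of_real (d x) * coord f x)"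
      by (simp add: norm_mult mult_ac)
  qed
  have "dmult m (dmult (\<lambda>x. of_real (d x)) f) = dmult (\<lambda>x. of_real (d x)) (dmult m f)"
    by (rule ell2_eqI)
      (use dm in \<open>simp add: dom_def cm coord_mult_l2[OF f] coord_mult_l2 algebra_simps\<close>)
  thus "dmult m (H f) - H (dmult m f) = dmult m (B f) - B (dmult m f)"
    by (simp add: H_def linear_add[OF linear_mult[of m, OF assms(2)]])
qed

context
  fixes U
  assumes U: "unitary_group_of U"
begin

lemma group_linear: "linear (U t)" and group_imul: "U t (imul f) = imul (U t f)"
  and group_norm: "norm (U t f) = norm f" and group_0: "U 0 f = f"
  and group_add: "U (s + t) f = U s (U t f)" and group_continuous: "continuous_on UNIV (\<lambda>t. U t f)"
  and group_dom: "f \<in> dom \<longleftrightarrow> (\<exists>g. ((\<lambda>t. (1 / t) *\<^sub>R (U t f - f)) \<longlongrightarrow> g) (at 0))"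
  and group_generator: "f \<in> dom \<Longrightarrow> ((\<lambda>t. (1 / t) *\<^sub>R (U t f - f)) \<longlongrightarrow> imul (H f)) (at 0)"
  using U unfolding unitary_group_of_def by blast+

lemma group_bounded_linear: "bounded_linear (U t)"
  using group_linear[of t] group_norm by (intro bounded_linear.intro) (auto simp: bounded_linear_axioms_def intro: exI[of _ 1])

text \<open>Polarization (\<open>dot_norm\<close>) turns preservation of norms into preservation of
  inner products, and \<open>U (- t)\<close> inverts \<open>U t\<close>.\<close>

lemma inner_group: "inner (U t f) g = inner f (U (- t) g)"
proof -
  have "g = U t (U (- t) g)" using group_add[of t "- t" g] group_0 by simp
  hence "inner (U t f) g = inner (U t f) (U t (U (- t) g))" by simp
  also have "\<dots> = inner f (U (- t) g)"
    unfolding dot_norm linear_add[OF group_linear, symmetric] group_norm ..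
  finally show ?thesis .
qed

text \<open>\<open>U t\<close> maps the difference quotient at \<open>f\<close> to the one at
  \<open>U t f\<close>, so its continuity transports the limit.\<close>

lemma group_invariant_dom_derivative:
  assumes "f \<in> dom"
  shows "U t f \<in> dom" "((\<lambda>t. U t f) has_vector_derivative imul (H (U t f))) (at t)"
proof -
  have eq: "U t ((1 / h) *\<^sub>R (U h f - f)) = (1 / h) *\<^sub>R (U h (U t f) - U t f)" for h
    by (simp add: linear_diff[OF group_linear] linear_scale[OF group_linear] group_add[symmetric] add.commute)
  have lim: "((\<lambda>h. (1 / h) *\<^sub>R (U h (U t f) - U t f)) \<longlongrightarrow> U t (imul (H f))) (at 0)"
    unfolding eq[symmetric]
    by (rule bounded_linear.tendsto[OF group_bounded_linear group_generator[OF assms]])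
  thus dom: "U t f \<in> dom" unfolding group_dom by blast
  show "((\<lambda>t. U t f) has_vector_derivative imul (H (U t f))) (at t)"
    using group_generator[OF dom] unfolding has_vector_derivative_iff_quotient
    by (simp add: group_add[symmetric] add.commute)
qed

text \<open>The function \<open>s \<mapsto> \<langle>\<phi> U(s) f, U(s - 1) g\<rangle>\<close> interpolates between
  \<open>\<langle>U(1) \<phi> f, g\<rangle>\<close> and \<open>\<langle>\<phi> U(1) f, g\<rangle>\<close>; the diagonal part of \<open>H\<close> disappears from its derivative.\<close>

lemma norm_group_commutator_le:
  fixes \<phi> :: "'a \<Rightarrow> real"
  defines "\<Phi> \<equiv> dmult (\<lambda>x. of_real (\<phi> x))"
  assumes \<phi>: "\<And>x. \<bar>\<phi> x\<bar> \<le> C"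
    and comm: "\<And>f. norm (\<Phi> (B f) - B (\<Phi> f)) \<le> \<delta> * norm f"
    and dense: "closure dom = UNIV"
  shows "norm (\<Phi> (U 1 f) - U 1 (\<Phi> f)) \<le> \<delta> * norm f"
proof -
  have \<phi>': "cmod (of_real (\<phi> x)) \<le> C" for x using \<phi> by simp
  have bl: "bounded_linear \<Phi>" unfolding \<Phi>_def by (rule bounded_linear_mult[OF \<phi>'])
  have \<Phi>_sym: "inner (\<Phi> f) g = inner f (\<Phi> g)" for f g
    unfolding \<Phi>_def using inner_mult[OF \<phi>'] by simp
  have \<Phi>_imul: "\<Phi> (imul f) = imul (\<Phi> f)" for f
    unfolding \<Phi>_def by (rule imul_mult_commute[OF \<phi>', symmetric])
  have main: "\<bar>inner (\<Phi> (U 1 f) - U 1 (\<Phi> f)) g\<bar> \<le> \<delta> * norm f * norm g"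
    if f: "f \<in> dom" and g: "g \<in> dom" for f g
  proof -
    define \<psi> where "\<psi> s = inner (\<Phi> (U s f)) (U (s - 1) g)" for s
    define \<psi>' where "\<psi>' s = inner (\<Phi> (U s f)) (imul (H (U (s - 1) g))) +
      inner (\<Phi> (imul (H (U s f)))) (U (s - 1) g)" for s
    have deriv: "(\<psi> has_real_derivative \<psi>' s) (at s)" for s
    proof -
      have 1: "((\<lambda>s. \<Phi> (U s f)) has_vector_derivative \<Phi> (imul (H (U s f)))) (at s)"
        by (rule bounded_linear.has_vector_derivative[OF bl group_invariant_dom_derivative(2)[OF f]])
      have 2: "((\<lambda>s. U (s - 1) g) has_vector_derivative imul (H (U (s - 1) g))) (at s)"
      proof -
        have "((\<lambda>s. s - 1) has_vector_derivative 1) (at s)"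
          by (auto intro!: derivative_eq_intros)
        from vector_diff_chain_at[OF this group_invariant_dom_derivative(2)[OF g, of "s - 1"]]
        show ?thesis by (simp add: o_def)
      qed
      show ?thesis
        using bounded_bilinear.has_vector_derivative[OF bounded_bilinear_inner 1 2]
        unfolding \<psi>_def \<psi>'_def has_real_derivative_iff_has_vector_derivative by simp
    qed
    have bound: "\<bar>\<psi>' s\<bar> \<le> \<delta> * norm f * norm g" for s
    proof -
      define a b where "a = U s f" and "b = U (s - 1) g"
      have ab: "a \<in> dom" "b \<in> dom"
        using f g unfolding a_def b_def by (auto intro: group_invariant_dom_derivative)
      have \<Phi>a: "\<Phi> a \<in> dom" and ca: "\<Phi> (H a) - H (\<Phi> a) = \<Phi> (B a) - B (\<Phi> a)"
        unfolding \<Phi>_def using dom_dmult[OF ab(1) \<phi>'] by auto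
      \<comment> \<open>The generator is moved to the left factor: \<open>imul\<close> is skew,
        while \<open>H\<close> is symmetric and commutes with \<open>imul\<close> on
        \<open>dom\<close>, to which \<open>\<Phi> a\<close> belongs. The two terms of the
        derivative then combine to the commutator of \<Phi> with \<open>H\<close>, that is, with
        \<open>B\<close>.\<close>
      have "inner (\<Phi> a) (imul (H b)) = - inner (imul (\<Phi> a)) (H b)" by (simp add: inner_imul)
      also have "\<dots> = - inner (imul (H (\<Phi> a))) b"
      proof -
        have i: "imul (\<Phi> a) \<in> dom" using dom_dmult(1)[OF \<Phi>a, of "\<lambda>_. \<i>" 1] by simp
        have "H (imul (\<Phi> a)) = imul (H (\<Phi> a))"
          using dom_dmult(2)[OF \<Phi>a, of "\<lambda>_. \<i>" 1] by (simp add: B_imul)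
        thus ?thesis using H_symmetric[OF i ab(2)] by simp
      qed
      finally have "\<psi>' s = inner (imul (\<Phi> (B a) - B (\<Phi> a))) b"
        unfolding \<psi>'_def a_def[symmetric] b_def[symmetric] ca[symmetric] \<Phi>_imul
        by (simp add: linear_diff[OF bounded_linear.linear[OF bounded_linear_imul]] inner_diff_left)
      hence "\<bar>\<psi>' s\<bar> \<le> norm (\<Phi> (B a) - B (\<Phi> a)) * norm b"
        using Cauchy_Schwarz_ineq2[of "imul (\<Phi> (B a) - B (\<Phi> a))" b] by simp
      also have "\<dots> \<le> \<delta> * norm a * norm b" by (intro mult_right_mono comm) auto
      finally show ?thesis by (simp add: a_def b_def group_norm)
    qed
    obtain z where "\<psi> 1 - \<psi> 0 = (1 - 0) * \<psi>' z"
      using MVT2[of 0 1 \<psi> \<psi>'] deriv by auto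
    moreover have "\<psi> 1 - \<psi> 0 = inner (\<Phi> (U 1 f) - U 1 (\<Phi> f)) g"
      by (simp add: \<psi>_def group_0 inner_diff_left inner_group)
    ultimately show ?thesis using bound[of z] by simp
  qed
  have comm_bl: "bounded_linear (\<lambda>f. \<Phi> (U 1 f) - U 1 (\<Phi> f))"
    by (intro bounded_linear_sub bounded_linear_compose[OF bl] bounded_linear_compose[OF group_bounded_linear]
        group_bounded_linear bl)
  have "norm (\<Phi> (U 1 f) - U 1 (\<Phi> f)) \<le> \<delta> * norm f" if f: "f \<in> dom" for f
  proof -
    define h where "h = \<Phi> (U 1 f) - U 1 (\<Phi> f)"
    \<comment> \<open>From weak to norm estimate: for fixed \<open>f\<close> density extends the
      bound to all \<open>g\<close>, and \<open>g = h\<close> is then allowed.\<close>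
    have "norm (inner h g) \<le> (\<delta> * norm f) * norm g" for g
      by (rule norm_le_on_dense[OF bounded_linear_inner_right dense]) (use main[OF f] in \<open>simp add: h_def\<close>)
    from this[of h] have "norm h * norm h \<le> \<delta> * norm f * norm h"
      by (simp add: norm_eq_sqrt_inner)
    \<comment> \<open>\<open>comm\<close> makes \<open>\<delta> * norm f\<close> nonnegative, which
      settles the case \<open>h = 0\<close>; otherwise \<open>norm h\<close> cancels.\<close>
    thus ?thesis
      using order_trans[OF norm_ge_zero comm[of f]] unfolding h_def[symmetric]
      by (cases "norm h = 0") auto
  qed
  thus ?thesis by (rule norm_le_on_dense[OF comm_bl dense])
qed

end

end

subsection \<open>Operators on functions and operators on \<open>ell2\<close>\<close>

lemma l2norm_ell2_of: "f \<in> l2 \<Longrightarrow> norm (ell2_of f) = l2norm f"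
  by (simp add: norm_ell2_l2norm)

lemma coord_simps:
  "coord (f + g) = coord f + coord g" "coord (f - g) = coord f - coord g"
  "coord (dmult (\<lambda>_. c) f) = scv c (coord f)" "coord 0 = 0"
  by (auto simp: fun_eq_iff scv_def coord_mult[where C = "cmod c"])

text \<open>Reduces complex homogeneity to real homogeneity and commutation with
  \<open>imul\<close>.\<close>

lemma dmult_const: "dmult (\<lambda>_. c) f = Re c *\<^sub>R f + Im c *\<^sub>R imul f"
  by (rule ell2_eqI) (simp add: coord_mult[where C = "cmod c"] complex_eq_iff)

lemma scv_of_real: "scv (of_real c) (coord f) = coord (c *\<^sub>R f)"
  by (auto simp: fun_eq_iff scv_def)

text \<open>The complex inner product is conjugate linear in its second argument, so pairing with
  \<open>imul g\<close> multiplies it by -\<i> and brings its imaginary part into the real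
  part.\<close>

lemma l2inner_coord: "l2inner (coord f) (coord g) = Complex (inner f g) (inner f (imul g))"
proof -
  have "l2inner (coord f) (coord (imul g)) = - \<i> * l2inner (coord f) (coord g)"
    unfolding l2inner_def infsum_cmult_right'[symmetric] by (intro infsum_cong) simp
  thus ?thesis by (simp add: inner_ell2_l2inner complex_eq_iff)
qed

lemma l2inner_delta_right [simp]: "l2inner f (delta y) = f y"
proof -
  have "l2inner f (delta y) = infsum (\<lambda>x. f x * cnj (delta y x)) {y}"
    unfolding l2inner_def by (rule infsum_cong_neutral) (auto simp: delta_def)
  thus ?thesis by (simp add: delta_def)
qed

lemma l2inner_delta_left [simp]: "l2inner (delta y) f = cnj (f y)"
proof -
  have "l2inner (delta y) f = infsum (\<lambda>x. delta y x * cnj (f x)) {y}"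
    unfolding l2inner_def by (rule infsum_cong_neutral) (auto simp: delta_def)
  thus ?thesis by (simp add: delta_def)
qed

lemma delta_c00: "delta x \<in> c00"
  by (auto simp: c00_def delta_def intro: finite_subset[of _ "{x}"])

lemma l2_coordD: "F \<in> l2 \<Longrightarrow> \<exists>f. F = coord f"
  by (metis ell2_of_inverse)

lemma lin_op_coord:
  assumes "linear L" "\<And>f. L (imul f) = imul (L f)"
  shows "lin_op l2 (\<lambda>f. coord (L (ell2_of f :: 'a ell2)))"
proof -
  have L: "L (dmult (\<lambda>_. c) f) = dmult (\<lambda>_. c) (L f)" for c f
    unfolding dmult_const[of c] by (simp add: linear_add[OF assms(1)] linear_scale[OF assms(1)] assms(2))
  have add: "F + G \<in> l2 \<and> coord (L (ell2_of (F + G))) = coord (L (ell2_of F)) + coord (L (ell2_of G))"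
    if F: "F \<in> l2" and G: "G \<in> l2" for F G
  proof -
    obtain f g where fg: "F = coord f" "G = coord g" using l2_coordD[OF F] l2_coordD[OF G] by blast
    show ?thesis
      unfolding fg coord_simps(1)[symmetric] by (simp add: linear_add[OF assms(1)])
  qed
  have scale: "scv c F \<in> l2 \<and> coord (L (ell2_of (scv c F))) = scv c (coord (L (ell2_of F)))"
    if F: "F \<in> l2" for F c
  proof -
    obtain f where f: "F = coord f" using l2_coordD[OF F] by blast
    show ?thesis unfolding f coord_simps(3)[symmetric] by (simp add: L)
  qed
  have "0 \<in> (l2 :: 'a vec set)" using l2_zero by (simp add: zero_fun_def)
  thus ?thesis unfolding lin_op_def
    by (intro conjI ballI allI subset_refl add[THEN conjunct1] add[THEN conjunct2]
        scale[THEN conjunct1] scale[THEN conjunct2] coord)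
qed

lemma linear_of_lin_op:
  assumes "lin_op l2 W"
  shows "linear (\<lambda>f. ell2_of (W (coord f)))"
    and "ell2_of (W (coord (imul f))) = imul (ell2_of (W (coord f)))"
    and "coord (ell2_of (W (coord f))) = W (coord f)"
proof -
  have W: "W (coord f) \<in> l2" "W (coord f + coord g) = W (coord f) + W (coord g)"
    "W (scv c (coord f)) = scv c (W (coord f))" for f g c
    using assms by (auto simp: lin_op_def)
  have co: "coord (ell2_of (W (coord f))) = W (coord f)" for f
    using W(1) by simp
  show "coord (ell2_of (W (coord f))) = W (coord f)" by (rule co)
  have sc: "ell2_of (W (coord (dmult (\<lambda>_. c) f))) = dmult (\<lambda>_. c) (ell2_of (W (coord f)))" for c f
    unfolding coord_inject[symmetric] co unfolding coord_simps co W ..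
  show "ell2_of (W (coord (imul f))) = imul (ell2_of (W (coord f)))" by (rule sc)
  show "linear (\<lambda>f. ell2_of (W (coord f)))"
  proof (rule linearI)
    show "ell2_of (W (coord (f + g))) = ell2_of (W (coord f)) + ell2_of (W (coord g))" for f g
      unfolding coord_inject[symmetric] co unfolding coord_simps co W ..
    show "ell2_of (W (coord (c *\<^sub>R f))) = c *\<^sub>R ell2_of (W (coord f))" for c f
      using sc[of "of_real c" f] by (simp add: dmult_const[of "of_real c"])
  qed
qed

section \<open>Transport of unitary groups between \<open>ell2\<close> and functions\<close>

context diagonal_perturbation
begin

lemma generated_group_of_unitary_group:
  assumes U: "unitary_group_of U"
    and D: "D = coord ` dom" and T: "\<And>f. f \<in> dom \<Longrightarrow> T (coord f) = coord (H f)"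
  shows "generated_group D T (\<lambda>t f. coord (U t (ell2_of f)))"
  unfolding generated_group_def
proof (intro conjI allI ballI)
  note gr = group_linear[OF U] group_imul[OF U] group_norm[OF U] group_0[OF U] group_add[OF U]
  show "unitary (\<lambda>f. coord (U t (ell2_of f)))" for t
    unfolding unitary_def
  proof (intro conjI ballI)
    show "lin_op l2 (\<lambda>f. coord (U t (ell2_of f)))" by (intro lin_op_coord gr)
    show "l2norm (coord (U t (ell2_of f))) = l2norm f" if "f \<in> l2" for f
      using that by (simp add: norm_ell2_l2norm[symmetric] l2norm_ell2_of gr)
    have "g \<in> (\<lambda>f. coord (U t (ell2_of f))) ` l2" if "g \<in> l2" for g
    proof (rule image_eqI)
      show "g = coord (U t (ell2_of (coord (U (- t) (ell2_of g)))))"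
        using that gr(5)[of t "- t" "ell2_of g"] by (simp add: gr(4))
    qed simp
    thus "(\<lambda>f. coord (U t (ell2_of f))) ` l2 = l2" by auto
  qed
  fix F :: "'a vec" assume "F \<in> l2"
  then obtain f where F: "F = coord f" using l2_coordD by blast
  show "coord (U 0 (ell2_of F)) = F" by (simp add: F gr)
  show "coord (U (s + t) (ell2_of F)) = coord (U s (ell2_of (coord (U t (ell2_of F)))))" for s t
    by (simp add: F gr(5))
  have "continuous_on UNIV (\<lambda>t. U t f)" by (rule group_continuous[OF U])
  hence "((\<lambda>t. U t f - U s f) \<longlongrightarrow> 0) (at s)" for s
    by (intro LIM_zero) (auto simp: continuous_on_def)
  thus "((\<lambda>t. l2norm (coord (U t (ell2_of F)) - coord (U s (ell2_of F)))) \<longlongrightarrow> 0) (at s)" for s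
    by (simp add: F coord_simps(2)[symmetric] norm_ell2_l2norm[symmetric] tendsto_norm_zero)
  have lim: "((\<lambda>t. l2norm (scv (of_real (1 / t)) (coord (U t (ell2_of F)) - F) - coord g)) \<longlongrightarrow> 0) (at 0) \<longleftrightarrow>
    ((\<lambda>t. (1 / t) *\<^sub>R (U t f - f)) \<longlongrightarrow> g) (at 0)" for g
    unfolding F coord_inverse coord_simps(2)[symmetric] scv_of_real norm_ell2_l2norm[symmetric]
      tendsto_norm_zero_iff LIM_zero_iff ..
  have "F \<in> D \<longleftrightarrow> f \<in> dom" by (auto simp: F D coord_inject)
  also have "\<dots> \<longleftrightarrow> (\<exists>g. ((\<lambda>t. (1 / t) *\<^sub>R (U t f - f)) \<longlongrightarrow> g) (at 0))" by (rule group_dom[OF U])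
  finally show "F \<in> D \<longleftrightarrow> (\<exists>G\<in>l2. ((\<lambda>t. l2norm (scv (of_real (1 / t)) (coord (U t (ell2_of F)) - F) - G)) \<longlongrightarrow> 0) (at 0))"
    unfolding lim[symmetric] using l2_coordD by fastforce
next
  fix F assume "F \<in> D"
  then obtain f where F: "F = coord f" "f \<in> dom" by (auto simp: D)
  have scvT: "scv \<i> (T (coord f)) = coord (imul (H f))"
    by (simp only: coord_simps(3) T[OF F(2)])
  have "((\<lambda>t. (1 / t) *\<^sub>R (U t f - f)) \<longlongrightarrow> imul (H f)) (at 0)"
    by (rule group_generator[OF U F(2)])
  thus "((\<lambda>t. l2norm (scv (of_real (1 / t)) (coord (U t (ell2_of F)) - F) - scv \<i> (T F))) \<longlongrightarrow> 0) (at 0)"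
    unfolding F(1) scvT coord_inverse coord_simps(2)[symmetric] scv_of_real
      norm_ell2_l2norm[symmetric] tendsto_norm_zero_iff LIM_zero_iff .
qed

lemma unitary_group_of_generated_group:
  assumes W: "generated_group D T W"
    and D: "D = coord ` dom" and T: "\<And>f. f \<in> dom \<Longrightarrow> T (coord f) = coord (H f)"
  shows "unitary_group_of (\<lambda>t f. ell2_of (W t (coord f)))"
  unfolding unitary_group_of_def
proof (intro conjI allI ballI)
  note W' = W[unfolded generated_group_def]
  have un: "unitary (W t)" for t using W' by blast
  hence lin: "lin_op l2 (W t)" for t by (simp add: unitary_def)
  note lo = linear_of_lin_op[OF lin]
  show "linear (\<lambda>f. ell2_of (W t (coord f)))"
    "ell2_of (W t (coord (imul f))) = imul (ell2_of (W t (coord f)))" for t f by (rule lo)+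
  show "norm (ell2_of (W t (coord f))) = norm f" for t f
    using un[of t] unfolding norm_ell2_l2norm lo by (simp add: unitary_def)
  show "ell2_of (W 0 (coord f)) = f" for f using W' coord[of f] by (metis coord_inverse)
  show "ell2_of (W (s + t) (coord f)) = ell2_of (W s (coord (ell2_of (W t (coord f)))))" for s t f
    unfolding lo using W' coord[of f] by metis
  have "((\<lambda>t. l2norm (W t (coord f) - W s (coord f))) \<longlongrightarrow> 0) (at s)" for f s
    using W' coord[of f] by blast
  moreover have "W t (coord f) - W s (coord f) = coord (ell2_of (W t (coord f)) - ell2_of (W s (coord f)))" for s t f
    by (simp only: coord_simps(2) lo(3))
  ultimately have "((\<lambda>t. ell2_of (W t (coord f))) \<longlongrightarrow> ell2_of (W s (coord f))) (at s)" for f s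
    by (simp only: norm_ell2_l2norm[symmetric] tendsto_norm_zero_iff LIM_zero_iff)
  thus "continuous_on UNIV (\<lambda>t. ell2_of (W t (coord f)))" for f
    by (simp add: continuous_on_def)
  have lim: "((\<lambda>t. l2norm (scv (of_real (1 / t)) (W t (coord f) - coord f) - coord g)) \<longlongrightarrow> 0) (at 0) \<longleftrightarrow>
    ((\<lambda>t. (1 / t) *\<^sub>R (ell2_of (W t (coord f)) - f)) \<longlongrightarrow> g) (at 0)" for f g
  proof -
    have "scv (of_real (1 / t)) (W t (coord f) - coord f) - coord g
      = coord ((1 / t) *\<^sub>R (ell2_of (W t (coord f)) - f) - g)" for t
      unfolding coord_simps(2) scv_of_real[symmetric] lo(3) ..
    thus ?thesis by (simp only: norm_ell2_l2norm[symmetric] tendsto_norm_zero_iff LIM_zero_iff)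
  qed
  have "f \<in> dom \<longleftrightarrow> coord f \<in> D" for f by (auto simp: D coord_inject)
  also have "coord f \<in> D \<longleftrightarrow> (\<exists>G\<in>l2. ((\<lambda>t. l2norm (scv (of_real (1 / t)) (W t (coord f) - coord f) - G)) \<longlongrightarrow> 0) (at 0))" for f
    using W' coord[of f] by blast
  finally show "f \<in> dom \<longleftrightarrow> (\<exists>g. ((\<lambda>t. (1 / t) *\<^sub>R (ell2_of (W t (coord f)) - f)) \<longlongrightarrow> g) (at 0))" for f
    unfolding lim[symmetric] using l2_coordD by fastforce
  fix f assume f: "f \<in> dom"
  hence "((\<lambda>t. l2norm (scv (of_real (1 / t)) (W t (coord f) - coord f) - scv \<i> (T (coord f)))) \<longlongrightarrow> 0) (at 0)"
    using W' D by blast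
  thus "((\<lambda>t. (1 / t) *\<^sub>R (ell2_of (W t (coord f)) - f)) \<longlongrightarrow> imul (H f)) (at 0)"
    unfolding T[OF f] coord_simps(3)[symmetric] lim .
qed

lemma closure_dom: "closure dom = UNIV"
proof -
  have "(\<lambda>x. of_real (d x) * f x) \<in> l2" if "f \<in> c00" for f
    using that by (intro c00_l2) (auto simp: c00_def elim: rev_finite_subset)
  hence "{f. coord f \<in> c00} \<subseteq> dom" by (auto simp: dom_def)
  from closure_mono[OF this] show ?thesis by (auto simp: closure_finitely_supported)
qed

end

subsection \<open>Operators given by matrices\<close>

abbreviation cscale :: "complex \<Rightarrow> 'a ell2 \<Rightarrow> 'a ell2"
  where "cscale c \<equiv> dmult (\<lambda>_. c)"

lemma coord_cscale [simp]: "coord (cscale c f) x = c * coord f x"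
  by (rule coord_mult[where C = "cmod c"]) simp

lemma inner_cscale: "inner f (cscale c g) = Re (cnj c * l2inner (coord f) (coord g))"
  by (simp add: dmult_const[of c] l2inner_coord inner_add_right)

text \<open>The entries of \<open>matrix_op c f\<close> are inner products with the columns, so the bound for
  arbitrary \<open>f\<close> follows by duality from a bound on finitely supported vectors.\<close>

definition matrix_op :: "('a \<Rightarrow> 'a ell2) \<Rightarrow> 'a ell2 \<Rightarrow> 'a ell2"
  where "matrix_op c f = ell2_of (\<lambda>x. l2inner (coord f) (coord (c x)))"

text \<open>\<open>c y\<close> is the column with index \<open>y\<close>. The bound concerns only
  finite combinations of columns, which make sense before any operator has been constructed.\<close>

locale bounded_hermitian_matrix =
  fixes c :: "'a \<Rightarrow> 'a ell2" and K :: real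
  assumes hermitian: "coord (c y) x = cnj (coord (c x) y)"
    and K: "0 \<le> K"
    and bound: "\<And>S w. finite S \<Longrightarrow> (norm (\<Sum>y\<in>S. cscale (w y) (c y)))\<^sup>2 \<le> K\<^sup>2 * (\<Sum>y\<in>S. (cmod (w y))\<^sup>2)"
begin

lemma sum_entries_le:
  assumes S: "finite S"
  shows "(\<Sum>x\<in>S. (cmod (l2inner (coord f) (coord (c x))))\<^sup>2) \<le> (K * norm f)\<^sup>2"
proof -
  define w where "w x = l2inner (coord f) (coord (c x))" for x
  define Q where "Q = (\<Sum>x\<in>S. (cmod (w x))\<^sup>2)"
  have Q0: "0 \<le> Q" by (simp add: Q_def sum_nonneg)
  have "Re (cnj (w x) * w x) = (cmod (w x))\<^sup>2" for x
    by (simp only: mult.commute[of "cnj _"] complex_norm_square[symmetric] Re_complex_of_real)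
  \<comment> \<open>The entries themselves serve as weights, so \<open>Q\<close> is a single inner
    product. Cauchy-Schwarz and \<open>bound\<close> then give
    \<open>Q * Q \<le> (K * norm f)\<^sup>2 * Q\<close>, from which a factor \<open>Q\<close>
    cancels.\<close>
  hence "Q = inner f (\<Sum>x\<in>S. cscale (w x) (c x))"
    by (simp only: Q_def inner_sum_right inner_cscale w_def)
  also have "\<dots> \<le> norm f * norm (\<Sum>x\<in>S. cscale (w x) (c x))"
    using Cauchy_Schwarz_ineq2 by (rule order_trans[OF abs_ge_self])
  finally have "Q\<^sup>2 \<le> (norm f * norm (\<Sum>x\<in>S. cscale (w x) (c x)))\<^sup>2"
    using Q0 by (rule power_mono)
  also have "\<dots> \<le> (norm f)\<^sup>2 * (K\<^sup>2 * Q)"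
    unfolding power_mult_distrib Q_def by (intro mult_left_mono bound S) auto
  finally have "Q * Q \<le> (K * norm f)\<^sup>2 * Q" by (simp add: power2_eq_square mult_ac)
  hence "Q \<le> (K * norm f)\<^sup>2" using Q0 by (cases "Q = 0") auto
  thus ?thesis by (simp add: Q_def w_def)
qed

lemma coord_matrix_op: "coord (matrix_op c f) x = l2inner (coord f) (coord (c x))"
  unfolding matrix_op_def by (subst ell2_of_inverse) (auto intro: l2I sum_entries_le)

lemma norm_matrix_op_le: "norm (matrix_op c f) \<le> K * norm f"
  unfolding norm_ell2_l2norm
  by (rule l2norm_le) (use sum_entries_le[of _ f] K in \<open>auto simp: coord_matrix_op norm_ell2_l2norm\<close>)

lemma bounded_linear_matrix_op: "bounded_linear (matrix_op c)"
proof (rule bounded_linear_intro[where K = K])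
  show "matrix_op c (f + g) = matrix_op c f + matrix_op c g" for f g
    by (rule ell2_eqI) (simp add: coord_matrix_op l2inner_coord inner_add_left complex_eq_iff)
  show "matrix_op c (r *\<^sub>R f) = r *\<^sub>R matrix_op c f" for r f
    by (rule ell2_eqI) (simp add: coord_matrix_op l2inner_coord complex_eq_iff)
  show "norm (matrix_op c f) \<le> norm f * K" for f
    using norm_matrix_op_le by (simp add: mult.commute)
qed

lemma matrix_op_imul: "matrix_op c (imul f) = imul (matrix_op c f)"
proof (rule ell2_eqI)
  fix x
  show "coord (matrix_op c (imul f)) x = coord (imul (matrix_op c f)) x"
    by (simp add: coord_matrix_op l2inner_coord inner_imul complex_eq_iff)
qed

lemma coord_matrix_op_finite_support:
  assumes "finite S" "\<And>x. x \<notin> S \<Longrightarrow> coord f x = 0"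
  shows "coord (matrix_op c f) x = (\<Sum>y\<in>S. coord f y * coord (c y) x)"
proof -
  have "coord (matrix_op c f) x = infsum (\<lambda>y. coord f y * coord (c y) x) UNIV"
    unfolding coord_matrix_op l2inner_def by (intro infsum_cong) (simp add: hermitian[of _ x])
  also have "\<dots> = infsum (\<lambda>y. coord f y * coord (c y) x) S"
    by (rule infsum_cong_neutral) (use assms(2) in auto)
  finally show ?thesis using assms(1) by simp
qed

text \<open>For finitely supported \<open>g\<close> the vector \<open>matrix_op c g\<close> is a
  finite combination of columns, so no infinite sums are interchanged; density and continuity do the
  rest.\<close>

lemma matrix_op_symmetric: "inner (matrix_op c f) g = inner f (matrix_op c g)"
proof -
  have *: "inner (matrix_op c f) g = inner f (matrix_op c g)" if "coord g \<in> c00" for g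
  proof -
    define S where "S = {x. coord g x \<noteq> 0}"
    have S: "finite S" "\<And>x. x \<notin> S \<Longrightarrow> coord g x = 0" using that by (auto simp: S_def c00_def)
    have "matrix_op c g = (\<Sum>y\<in>S. cscale (coord g y) (c y))"
      by (rule ell2_eqI) (simp add: coord_matrix_op_finite_support[OF S])
    hence "inner f (matrix_op c g) = (\<Sum>y\<in>S. Re (cnj (coord g y) * coord (matrix_op c f) y))"
      by (simp only: inner_sum_right inner_cscale coord_matrix_op)
    also have "\<dots> = infsum (\<lambda>y. Re (coord (matrix_op c f) y * cnj (coord g y))) S"
      using S(1) by (simp add: mult.commute)
    also have "\<dots> = inner (matrix_op c f) g"
      unfolding inner_ell2_def by (rule infsum_cong_neutral) (use S(2) in auto)
    finally show ?thesis by simp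
  qed
  have "closure {g. coord g \<in> c00} \<subseteq> {g. inner (matrix_op c f) g = inner f (matrix_op c g)}"
    using * by (intro closure_minimal closed_Collect_eq continuous_intros
      bounded_linear.continuous_on[OF bounded_linear_matrix_op]) auto
  thus ?thesis by (auto simp: closure_finitely_supported)
qed

end

text \<open>A row has at most \<open>N\<close> nonzero entries, so Cauchy-Schwarz on it costs a
  factor \<open>N\<close>; after the sums are exchanged each column index is counted at most
  \<open>N\<close> times, which costs the other.\<close>

lemma schur_bound:
  fixes k :: "'a::metric_space \<Rightarrow> 'a \<Rightarrow> complex"
  assumes k: "\<And>x y. cmod (k x y) \<le> K" "\<And>x y. k x y \<noteq> 0 \<Longrightarrow> dist x y \<le> R"
    and N: "\<And>x::'a. finite (cball x R) \<and> card (cball x R) \<le> N"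
    and S: "finite S" and F: "finite F"
  shows "(\<Sum>x\<in>F. (cmod (\<Sum>y\<in>S. k x y * w y))\<^sup>2) \<le> (real N * K)\<^sup>2 * (\<Sum>y\<in>S. (cmod (w y))\<^sup>2)"
proof -
  have K: "0 \<le> K" using order_trans[OF norm_ge_zero k(1)] .
  have row: "(cmod (\<Sum>y\<in>S. k x y * w y))\<^sup>2 \<le> real N * K\<^sup>2 * (\<Sum>y\<in>S. if dist x y \<le> R then (cmod (w y))\<^sup>2 else 0)" for x
  proof -
    let ?I = "S \<inter> cball x R"
    have "(\<Sum>y\<in>S. k x y * w y) = (\<Sum>y\<in>?I. k x y * w y)"
      using S k(2) by (intro sum.mono_neutral_right) auto
    hence "cmod (\<Sum>y\<in>S. k x y * w y) \<le> (\<Sum>y\<in>?I. K * cmod (w y))"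
      by (auto intro!: sum_norm_le simp: norm_mult mult_right_mono k(1))
    hence "(cmod (\<Sum>y\<in>S. k x y * w y))\<^sup>2 \<le> (\<Sum>y\<in>?I. K * cmod (w y))\<^sup>2" by (intro power_mono) auto
    also have "\<dots> \<le> (\<Sum>y\<in>?I. (K * cmod (w y))\<^sup>2) * real (card ?I)"
      by (rule sum_squared_le_sum_of_squares)
    also have "\<dots> \<le> (\<Sum>y\<in>?I. (K * cmod (w y))\<^sup>2) * real N"
      using card_mono[of "cball x R" ?I] N[of x] by (intro mult_left_mono sum_nonneg) auto
    also have "(\<Sum>y\<in>?I. (K * cmod (w y))\<^sup>2) = K\<^sup>2 * (\<Sum>y\<in>S. if dist x y \<le> R then (cmod (w y))\<^sup>2 else 0)"
      unfolding power_mult_distrib sum_distrib_left[symmetric] using S by (simp add: sum.inter_restrict)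
    finally show ?thesis by (simp add: mult_ac)
  qed
  have col: "(\<Sum>x\<in>F. if dist x y \<le> R then (cmod (w y))\<^sup>2 else 0) \<le> real N * (cmod (w y))\<^sup>2" for y
  proof -
    have "(\<Sum>x\<in>F. if dist x y \<le> R then (cmod (w y))\<^sup>2 else 0) = (\<Sum>x\<in>F \<inter> cball y R. (cmod (w y))\<^sup>2)"
      by (subst sum.inter_restrict[OF F]) (auto intro!: sum.cong simp: dist_commute)
    also have "\<dots> = real (card (F \<inter> cball y R)) * (cmod (w y))\<^sup>2" by simp
    also have "\<dots> \<le> real N * (cmod (w y))\<^sup>2"
      using card_mono[of "cball y R" "F \<inter> cball y R"] N[of y] by (intro mult_right_mono) auto
    finally show ?thesis .
  qed
  have "(\<Sum>x\<in>F. (cmod (\<Sum>y\<in>S. k x y * w y))\<^sup>2) \<le>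
      real N * K\<^sup>2 * (\<Sum>x\<in>F. \<Sum>y\<in>S. if dist x y \<le> R then (cmod (w y))\<^sup>2 else 0)"
    unfolding sum_distrib_left by (rule sum_mono) (use row in \<open>simp add: sum_distrib_left\<close>)
  also have "\<dots> \<le> real N * K\<^sup>2 * (\<Sum>y\<in>S. real N * (cmod (w y))\<^sup>2)"
    by (subst sum.swap) (intro mult_left_mono sum_mono col, auto)
  also have "\<dots> = (real N * K)\<^sup>2 * (\<Sum>y\<in>S. (cmod (w y))\<^sup>2)"
    by (simp add: sum_distrib_left[symmetric] power2_eq_square mult_ac)
  finally show ?thesis .
qed

definition fvec :: "'a set \<Rightarrow> 'a vec \<Rightarrow> 'a ell2"
  where "fvec S w = ell2_of (\<lambda>x. if x \<in> S then w x else 0)"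

lemma fvec_c00: "finite S \<Longrightarrow> (\<lambda>x. if x \<in> S then w x else 0) \<in> c00"
  by (auto simp: c00_def intro: finite_subset[of _ S])

lemma coord_fvec: "finite S \<Longrightarrow> coord (fvec S w) = (\<lambda>x. if x \<in> S then w x else 0)"
  unfolding fvec_def by (intro ell2_of_inverse c00_l2 fvec_c00)

lemma norm_fvec_square:
  assumes "finite S"
  shows "(norm (fvec S w))\<^sup>2 = (\<Sum>x\<in>S. (cmod (w x))\<^sup>2)"
proof -
  have "restr S (fvec S w) = fvec S w" by (rule ell2_eqI) (simp add: coord_fvec[OF assms])
  thus ?thesis using norm_restr_square[OF assms, of "fvec S w"] by (simp add: coord_fvec[OF assms])
qed

lemma schur_ell2:
  fixes k :: "'a::metric_space \<Rightarrow> 'a \<Rightarrow> complex"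
  assumes k: "\<forall>x y. cmod (k x y) \<le> K" "\<forall>x y. k x y \<noteq> 0 \<longrightarrow> dist x y \<le> R"
    and N: "\<forall>x::'a. finite (cball x R) \<and> card (cball x R) \<le> N"
    and S: "finite S"
  shows "\<exists>s. (\<forall>x. coord s x = (\<Sum>y\<in>S. k x y * w y)) \<and> norm s \<le> real N * K * norm (fvec S w)"
proof -
  have K: "0 \<le> K" using order_trans[OF norm_ge_zero k(1)[rule_format]] .
  have *: "(\<Sum>x\<in>F. (cmod (\<Sum>y\<in>S. k x y * w y))\<^sup>2) \<le> (real N * K * norm (fvec S w))\<^sup>2" if "finite F" for F
    using schur_bound[of k K R N S F w] k N S that by (simp add: power_mult_distrib norm_fvec_square[OF S])
  define s where "s = ell2_of (\<lambda>x. \<Sum>y\<in>S. k x y * w y)"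
  have s: "coord s = (\<lambda>x. \<Sum>y\<in>S. k x y * w y)"
    unfolding s_def by (intro ell2_of_inverse l2I[OF *])
  have "norm s \<le> real N * K * norm (fvec S w)"
    unfolding norm_ell2_l2norm[of s] s by (rule l2norm_le[OF *]) (use K in auto)
  thus ?thesis by (intro exI[of _ s]) (simp add: s)
qed

subsection \<open>Approximation by finite propagation operators\<close>

lemma lin_op_0: "lin_op D T \<Longrightarrow> T 0 = 0"
  unfolding lin_op_def by (metis add_cancel_right_right)

lemma delta_in_domain: "l2 \<inter> c00 \<subseteq> D \<Longrightarrow> delta x \<in> D"
  by (erule subsetD) (simp add: delta_c00 c00_l2)

lemma lin_op_fvec:
  assumes T: "lin_op D T" "l2 \<inter> c00 \<subseteq> D" and S: "finite S"
  shows "T (coord (fvec S w)) x = (\<Sum>y\<in>S. w y * T (delta y) x)"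
  using S
proof induction
  case empty
  have "coord (fvec {} w) = 0" by (simp add: coord_fvec zero_fun_def)
  hence "T (coord (fvec {} w)) = 0" using lin_op_0[OF T(1)] by (simp only:)
  thus ?case by (simp only: sum.empty zero_fun_apply)
next
  case (insert a S)
  have eq: "coord (fvec (insert a S) w) = scv (w a) (delta a) + coord (fvec S w)"
    using insert by (auto simp: coord_fvec fun_eq_iff scv_def delta_def)
  have D: "delta a \<in> D" "coord (fvec S w) \<in> D"
    using subsetD[OF T(2), of "coord (fvec S w)"] fvec_c00[OF insert(1), of w]
    by (auto simp: coord_fvec[OF insert(1)] c00_l2 delta_in_domain[OF T(2)])
  hence "scv (w a) (delta a) \<in> D" "T (scv (w a) (delta a)) = scv (w a) (T (delta a))"
    using T(1) unfolding lin_op_def by blast+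
  hence "T (coord (fvec (insert a S) w)) = scv (w a) (T (delta a)) + T (coord (fvec S w))"
    using T(1) D(2) unfolding lin_op_def eq by metis
  thus ?case using insert by (simp add: scv_def)
qed

lemma l2norm_delta: "l2norm (delta x) = 1"
proof -
  have "infsum (\<lambda>y. (cmod (delta x y))\<^sup>2) UNIV = infsum (\<lambda>y. (cmod (delta x y))\<^sup>2) {x}"
    by (rule infsum_cong_neutral) (auto simp: delta_def)
  thus ?thesis by (simp add: l2norm_def delta_def)
qed

lemma lin_op_l2: "lin_op D T \<Longrightarrow> f \<in> D \<Longrightarrow> T f \<in> l2"
  by (simp add: lin_op_def)

lemma Cu_unb_lin_op: "in_Cu_unb D T \<Longrightarrow> lin_op D T" "in_Cu_unb D T \<Longrightarrow> l2 \<inter> c00 \<subseteq> D"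
  by (auto simp: in_Cu_unb_def admissible_def closed_op_def)

text \<open>Finitely supported vectors lie in both domains, so the difference can be measured on
  them whatever else \<open>D\<close> and \<open>D'\<close> have in common. The entrywise bound is
  the case of the unit vector \<open>delta y\<close>.\<close>

lemma Cu_unb_approximation:
  fixes D :: "'a::metric_space vec set"
  assumes T: "in_Cu_unb D T" and "0 < \<epsilon>"
  shows "\<exists>D' T' R. lin_op D' T' \<and> l2 \<inter> c00 \<subseteq> D' \<and> 0 < R \<and>
    (\<forall>x y. T' (delta y) x \<noteq> 0 \<longrightarrow> dist x y \<le> R) \<and>
    (\<forall>g\<in>c00. T g - T' g \<in> l2 \<and> l2norm (T g - T' g) \<le> \<epsilon> * l2norm g) \<and>
    (\<forall>x y. cmod (T (delta y) x - T' (delta y) x) \<le> \<epsilon>)"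
proof -
  obtain D' T' where fp: "finite_prop D' T'"
    and near: "\<And>\<xi>. \<xi> \<in> D \<inter> D' \<Longrightarrow> l2norm (T \<xi> - T' \<xi>) \<le> \<epsilon> * l2norm \<xi>"
    using assms unfolding in_Cu_unb_def by blast
  obtain R where R: "\<And>x y. l2inner (T' (delta x)) (delta y) \<noteq> 0 \<Longrightarrow> dist x y \<le> R"
    using fp by (auto simp: finite_prop_def)
  have T': "lin_op D' T'" "l2 \<inter> c00 \<subseteq> D'"
    using fp by (auto simp: finite_prop_def admissible_def closed_op_def)
  note T = Cu_unb_lin_op[OF T]
  have *: "T g - T' g \<in> l2 \<and> l2norm (T g - T' g) \<le> \<epsilon> * l2norm g" if "g \<in> c00" for g
  proof -
    have g: "g \<in> D \<inter> D'" using T(2) T'(2) c00_l2[OF that] that by blast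
    hence "T g \<in> l2" "T' g \<in> l2" using T(1) T'(1) unfolding lin_op_def by blast+
    thus ?thesis using near[OF g] l2_diff[of "T g" "T' g"] by (simp add: fun_diff_def)
  qed
  have "cmod (T (delta y) x - T' (delta y) x) \<le> \<epsilon>" for x y
    using cmod_le_l2norm[of "T (delta y) - T' (delta y)" x] *[OF delta_c00[of y]]
    by (simp add: l2norm_delta)
  \<comment> \<open>The given propagation bound may be zero or negative, while
    \<open>unif_loc_finite\<close> speaks of positive radii.\<close>
  moreover have "dist x y \<le> max R 1" if "T' (delta y) x \<noteq> 0" for x y
    using R[of y x] that by (simp add: dist_commute)
  ultimately show ?thesis
    using T' * by (intro exI[of _ D'] exI[of _ T'] exI[of _ "max R 1"]) simp
qed

text \<open>Closeness in operator norm of the off-diagonal part of \<open>T\<close> to the matrix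
  \<open>k\<close>, tested on finitely supported vectors. It is phrased with an error vector
  \<open>e\<close> for each of them because the off-diagonal part is not yet known to define a
  bounded operator.\<close>

definition approximates_offdiagonal :: "('a vec \<Rightarrow> 'a vec) \<Rightarrow> real \<Rightarrow> ('a \<Rightarrow> 'a \<Rightarrow> complex) \<Rightarrow> bool"
  where "approximates_offdiagonal T \<epsilon> k \<longleftrightarrow> (\<forall>S w. finite S \<longrightarrow>
    (\<exists>e. norm e \<le> \<epsilon> * norm (fvec S w) \<and>
      (\<forall>x. (\<Sum>y\<in>S. w y * (if x = y then 0 else T (delta y) x)) = coord e x + (\<Sum>y\<in>S. k x y * w y))))"

lemma approximates_offdiagonalD:
  assumes "approximates_offdiagonal T \<epsilon> k" "finite S"
  shows "\<exists>e. norm e \<le> \<epsilon> * norm (fvec S w) \<and>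
      (\<forall>x. (\<Sum>y\<in>S. w y * (if x = y then 0 else T (delta y) x)) = coord e x + (\<Sum>y\<in>S. k x y * w y))"
  using assms unfolding approximates_offdiagonal_def by (elim allE impE)

text \<open>The diagonal of the approximant is deleted too. If \<open>T - T'\<close> has norm at
  most \<open>\<epsilon> / 2\<close> on finitely supported vectors, its diagonal has size at most
  \<open>\<epsilon> / 2\<close>, and removing it costs the other half of \<epsilon>.\<close>

lemma offdiagonal_approximation:
  fixes D :: "'a::metric_space vec set"
  assumes T: "in_Cu_unb D T" and M: "\<forall>x y. x \<noteq> y \<longrightarrow> cmod (T (delta y) x) \<le> M" and \<epsilon>: "0 < \<epsilon>"
  shows "\<exists>k K R. 0 < R \<and> (\<forall>x y. cmod (k x y) \<le> K) \<and> (\<forall>x y. k x y \<noteq> 0 \<longrightarrow> dist x y \<le> R) \<and>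
    approximates_offdiagonal T \<epsilon> k"
proof -
  obtain D' T' R where T': "lin_op D' T'" "l2 \<inter> c00 \<subseteq> D'" and R: "0 < R"
    "\<And>x y. T' (delta y) x \<noteq> 0 \<Longrightarrow> dist x y \<le> R"
    and near: "\<And>g. g \<in> c00 \<Longrightarrow> T g - T' g \<in> l2 \<and> l2norm (T g - T' g) \<le> \<epsilon> / 2 * l2norm g"
    and entry: "\<And>x y. cmod (T (delta y) x - T' (delta y) x) \<le> \<epsilon> / 2"
    using Cu_unb_approximation[OF T half_gt_zero[OF \<epsilon>]] by metis
  define k where "k x y = (if x = y then 0 else T' (delta y) x)" for x y
  \<comment> \<open>An off-diagonal entry of \<open>T'\<close> differs from that of \<open>T\<close>
    by at most \<open>\<epsilon> / 2\<close>. The maximum with 0 covers one-point spaces, where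
    \<open>M\<close> is unconstrained.\<close>
  define K where "K = max M 0 + \<epsilon> / 2"
  have k: "cmod (k x y) \<le> K" for x y
  proof (cases "x = y")
    case False
    have "cmod (T' (delta y) x) \<le> cmod (T (delta y) x) + cmod (T (delta y) x - T' (delta y) x)"
      using norm_triangle_sub[of "T' (delta y) x" "T (delta y) x"] by (simp only: norm_minus_commute)
    thus ?thesis using M entry[of y x] False by (fastforce simp add: k_def K_def)
  qed (use \<epsilon> in \<open>simp add: k_def K_def\<close>)
  have "approximates_offdiagonal T \<epsilon> k"
    unfolding approximates_offdiagonal_def
  proof (intro allI impI)
    fix S :: "'a set" and w :: "'a vec" assume S: "finite S"
    let ?g = "fvec S w"
    define a where "a = ell2_of (T (coord ?g) - T' (coord ?g))"
    define m where "m x = T (delta x) x - T' (delta x) x" for x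
    have g: "coord ?g \<in> c00" using fvec_c00[OF S] by (simp add: coord_fvec[OF S])
    have a: "coord a = T (coord ?g) - T' (coord ?g)" unfolding a_def using near[OF g] by simp
    have na: "norm a \<le> \<epsilon> / 2 * norm ?g" using near[OF g] by (simp add: norm_ell2_l2norm a)
    have m: "cmod (m x) \<le> \<epsilon> / 2" for x unfolding m_def by (rule entry)
    have split: "(\<Sum>y\<in>S. w y * (if x = y then 0 else t y)) =
        (\<Sum>y\<in>S. w y * t y) - (if x \<in> S then w x * t x else 0)" for x and t :: "'a \<Rightarrow> complex"
    proof -
      have "(\<Sum>y\<in>S. w y * (if x = y then 0 else t y)) =
        (\<Sum>y\<in>S. w y * t y - (if x = y then w y * t y else 0))" by (intro sum.cong) auto
      also have "\<dots> = (\<Sum>y\<in>S. w y * t y) - (if x \<in> S then w x * t x else 0)"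
        unfolding sum_subtractf using S by simp
      finally show ?thesis .
    qed
    show "\<exists>e. norm e \<le> \<epsilon> * norm (fvec S w) \<and>
      (\<forall>x. (\<Sum>y\<in>S. w y * (if x = y then 0 else T (delta y) x)) = coord e x + (\<Sum>y\<in>S. k x y * w y))"
    proof (intro exI[of _ "a - dmult m ?g"] conjI allI)
      have "norm (a - dmult m ?g) \<le> norm a + norm (dmult m ?g)" by (rule norm_triangle_ineq4)
      thus "norm (a - dmult m ?g) \<le> \<epsilon> * norm ?g" using na norm_mult_le[of m, OF m, of ?g] by simp
      fix x
      have "(\<Sum>y\<in>S. k x y * w y) = (\<Sum>y\<in>S. w y * (if x = y then 0 else T' (delta y) x))"
        by (intro sum.cong) (auto simp: k_def)
      thus "(\<Sum>y\<in>S. w y * (if x = y then 0 else T (delta y) x)) =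
          coord (a - dmult m ?g) x + (\<Sum>y\<in>S. k x y * w y)"
        unfolding split coord_diff a coord_mult[of m, OF m]
        by (cases "x \<in> S") (simp_all add: coord_fvec[OF S] m_def lin_op_fvec[OF T' S, unfolded coord_fvec[OF S]] algebra_simps
            lin_op_fvec[OF Cu_unb_lin_op[OF T] S, unfolded coord_fvec[OF S]])
    qed
  qed
  moreover have "dist x y \<le> R" if "k x y \<noteq> 0" for x y
    using R(2)[of y x] that by (auto simp: k_def split: if_splits)
  ultimately show ?thesis using R(1) k by (intro exI[of _ k] exI[of _ K] exI[of _ R]) simp
qed

subsection \<open>Decomposition into a diagonal and a bounded operator\<close>

lemma ulf_card:
  assumes "unif_loc_finite TYPE('a::metric_space)" "0 < R"
  obtains N where "\<And>x::'a. finite (cball x R) \<and> card (cball x R) \<le> N"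
proof -
  obtain N where "\<forall>x::'a. finite (cball x R) \<and> card (cball x R) \<le> N"
    using assms unfolding unif_loc_finite_def by auto
  thus thesis using that by blast
qed

lemma hermitian_entries:
  assumes "self_adjoint D T" "l2 \<inter> c00 \<subseteq> D"
  shows "T (delta y) x = cnj (T (delta x) y)"
proof -
  have "delta x \<in> D" "delta y \<in> D" by (rule delta_in_domain[OF assms(2)])+
  hence "l2inner (T (delta y)) (delta x) = l2inner (delta y) (T (delta x))"
    using assms(1) unfolding self_adjoint_def by blast
  thus ?thesis by simp
qed

definition offdiag_col :: "('a vec \<Rightarrow> 'a vec) \<Rightarrow> 'a \<Rightarrow> 'a ell2"
  where "offdiag_col T y = ell2_of (\<lambda>x. if x = y then 0 else T (delta y) x)"

lemma coord_offdiag_col: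
  assumes "lin_op D T" "l2 \<inter> c00 \<subseteq> D"
  shows "coord (offdiag_col T y) x = (if x = y then 0 else T (delta y) x)"
proof -
  have "T (delta y) \<in> l2" by (rule lin_op_l2[OF assms(1) delta_in_domain[OF assms(2)]])
  hence "(\<lambda>x. if x = y then 0 else T (delta y) x) \<in> l2" by (rule l2_mono[where C = 1]) auto
  thus ?thesis by (simp add: offdiag_col_def)
qed

locale selfadjoint_Cu =
  fixes D :: "'a::metric_space vec set" and T :: "'a vec \<Rightarrow> 'a vec" and M :: real
  assumes ulf: "unif_loc_finite TYPE('a)"
    and sa: "self_adjoint D T" and Cu: "in_Cu_unb D T"
    and M: "\<forall>x y. x \<noteq> y \<longrightarrow> cmod (T (delta y) x) \<le> M"
begin

lemmas lin = Cu_unb_lin_op[OF Cu]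
lemmas hermitian_T = hermitian_entries[OF sa lin(2)]
lemmas coord_col = coord_offdiag_col[OF lin]

lemma sum_cols:
  "coord (\<Sum>y\<in>S. cscale (w y) (offdiag_col T y)) x = (\<Sum>y\<in>S. w y * (if x = y then 0 else T (delta y) x))"
  by (simp add: coord_col)

text \<open>A single approximation, here with error 1, is enough: the Schur test bounds the
  approximant by \<open>N * K\<close>, and the error adds 1.\<close>

lemma bounded_matrix: "\<exists>K. bounded_hermitian_matrix (offdiag_col T) K"
proof -
  obtain k K R where R: "0 < R" and k: "\<forall>x y. cmod (k x y) \<le> K" "\<forall>x y. k x y \<noteq> 0 \<longrightarrow> dist x y \<le> R"
    and appr: "approximates_offdiagonal T 1 k"
    using offdiagonal_approximation[OF Cu M zero_less_one] by metis
  obtain N where N: "\<forall>x::'a. finite (cball x R) \<and> card (cball x R) \<le> N" using ulf_card[OF ulf R] by blast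
  have "0 \<le> K" using order_trans[OF norm_ge_zero k(1)[rule_format]] .
  have "bounded_hermitian_matrix (offdiag_col T) (1 + real N * K)"
  proof
    show "coord (offdiag_col T y) x = cnj (coord (offdiag_col T x) y)" for x y
    proof (cases "x = y")
      case False
      thus ?thesis using hermitian_T[of y x] by (simp add: coord_col)
    qed (simp add: coord_col)
    show "0 \<le> 1 + real N * K" using \<open>0 \<le> K\<close> by simp
    fix S :: "'a set" and w :: "'a vec" assume S: "finite S"
    obtain e where e: "norm e \<le> norm (fvec S w)"
      "\<And>x. (\<Sum>y\<in>S. w y * (if x = y then 0 else T (delta y) x)) = coord e x + (\<Sum>y\<in>S. k x y * w y)"
      using approximates_offdiagonalD[OF appr S, of w] by (metis mult_1)
    obtain s where s: "\<And>x. coord s x = (\<Sum>y\<in>S. k x y * w y)" "norm s \<le> real N * K * norm (fvec S w)"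
      using schur_ell2[OF k N S, where w = w] by blast
    have "(\<Sum>y\<in>S. cscale (w y) (offdiag_col T y)) = e + s"
      by (rule ell2_eqI) (simp only: sum_cols e(2) s(1) coord_add)
    hence "norm (\<Sum>y\<in>S. cscale (w y) (offdiag_col T y)) \<le> (1 + real N * K) * norm (fvec S w)"
      using norm_triangle_ineq[of e s] e(1) s(2) by (simp add: algebra_simps)
    hence "(norm (\<Sum>y\<in>S. cscale (w y) (offdiag_col T y)))\<^sup>2 \<le> ((1 + real N * K) * norm (fvec S w))\<^sup>2"
      by (rule power_mono) simp
    thus "(norm (\<Sum>y\<in>S. cscale (w y) (offdiag_col T y)))\<^sup>2 \<le> (1 + real N * K)\<^sup>2 * (\<Sum>y\<in>S. (cmod (w y))\<^sup>2)"
      by (simp only: power_mult_distrib norm_fvec_square[OF S])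
  qed
  thus ?thesis by blast
qed

text \<open>Taking the real part loses nothing, because diagonal entries are real by
  \<open>hermitian_T\<close>.\<close>

definition diag :: "'a \<Rightarrow> real" where "diag x = Re (T (delta x) x)"
definition offdiag :: "'a ell2 \<Rightarrow> 'a ell2" where "offdiag = matrix_op (offdiag_col T)"

lemma perturbation: "diagonal_perturbation offdiag"
proof -
  obtain K where "bounded_hermitian_matrix (offdiag_col T) K" using bounded_matrix by blast
  then interpret bounded_hermitian_matrix "offdiag_col T" K .
  show ?thesis unfolding offdiag_def
    by (intro diagonal_perturbation.intro bounded_linear_matrix_op matrix_op_imul matrix_op_symmetric)
qed

sublocale diagonal_perturbation diag offdiag by (rule perturbation)

lemma T_delta: "T (delta x) = coord (offdiag_col T x + diag x *\<^sub>R ell2_of (delta x))"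
proof -
  have "T (delta x) x = of_real (diag x)"
    using arg_cong[OF hermitian_T[of x x], of Im] by (simp add: diag_def complex_eq_iff)
  moreover have "coord (ell2_of (delta x)) = delta x" by (simp add: delta_c00 c00_l2)
  ultimately show ?thesis by (auto simp: fun_eq_iff coord_col delta_def)
qed

lemma l2inner_T_delta: "l2inner (coord f) (T (delta x)) = coord (offdiag f) x + of_real (diag x) * coord f x"
proof -
  obtain K where "bounded_hermitian_matrix (offdiag_col T) K" using bounded_matrix by blast
  then interpret m: bounded_hermitian_matrix "offdiag_col T" K .
  have d: "coord (ell2_of (delta x)) = delta x" by (simp add: delta_c00 c00_l2)
  have "l2inner (coord f) (T (delta x)) = l2inner (coord f) (coord (offdiag_col T x)) +
     of_real (diag x) * l2inner (coord f) (coord (ell2_of (delta x)))"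
    unfolding T_delta l2inner_coord
    by (simp add: complex_eq_iff inner_add_right linear_add[OF bounded_linear.linear[OF bounded_linear_imul]]
        linear_scale[OF bounded_linear.linear[OF bounded_linear_imul]])
  thus ?thesis by (simp add: offdiag_def m.coord_matrix_op d)
qed

text \<open>Symmetry against \<open>delta x\<close> computes every coordinate of
  \<open>T (coord f)\<close>. Subtracting the square summable \<open>offdiag f\<close> leaves the
  product of \<open>diag\<close> and \<open>f\<close>, which is therefore square summable.\<close>

lemma T_eq:
  assumes "coord f \<in> D"
  shows "f \<in> dom" "T (coord f) = coord (H f)"
proof -
  have T: "T (coord f) x = coord (offdiag f) x + of_real (diag x) * coord f x" for x
  proof -
    have "delta x \<in> D" by (rule delta_in_domain[OF lin(2)])
    hence "l2inner (T (coord f)) (delta x) = l2inner (coord f) (T (delta x))"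
      using sa assms unfolding self_adjoint_def by blast
    thus ?thesis by (simp add: l2inner_T_delta)
  qed
  have "T (coord f) \<in> l2" by (rule lin_op_l2[OF lin(1) assms])
  from l2_diff[OF this coord[of "offdiag f"]]
  show "f \<in> dom" by (simp add: T dom_def)
  hence "coord (H f) x = of_real (diag x) * coord f x + coord (offdiag f) x" for x
    unfolding H_def coord_add by (simp add: coord_mult_l2 dom_def)
  thus "T (coord f) = coord (H f)" by (simp add: fun_eq_iff T)
qed

lemma D_eq: "D = coord ` dom"
proof
  have "D \<subseteq> l2" using lin(1) by (simp add: lin_op_def)
  thus "D \<subseteq> coord ` dom" using T_eq(1) l2_coordD by blast
  show "coord ` dom \<subseteq> D"
  proof
    fix \<eta> assume "\<eta> \<in> coord ` dom"
    then obtain g where g: "\<eta> = coord g" "g \<in> dom" by blast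
    \<comment> \<open>\<open>H\<close> is symmetric and extends \<open>T\<close>, so
      \<open>g\<close> lies in the domain of the adjoint of \<open>T\<close>, which is
      \<open>D\<close>. Pairing with \<open>imul g\<close> as well yields the imaginary
      part.\<close>
    have "l2inner (T \<xi>) \<eta> = l2inner \<xi> (coord (H g))" if \<xi>: "\<xi> \<in> D" for \<xi>
    proof -
      obtain f where f: "\<xi> = coord f" using \<open>D \<subseteq> l2\<close> \<xi> l2_coordD by blast
      have fd: "f \<in> dom" "T \<xi> = coord (H f)" using T_eq[of f] \<xi> f by auto
      have i: "imul g \<in> dom" "H (imul g) = imul (H g)"
        using dom_dmult[OF g(2), of "\<lambda>_. \<i>" 1] by (auto simp: B_imul)
      show ?thesis
        unfolding fd(2) unfolding f g(1) l2inner_coord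
        using H_symmetric[OF fd(1) g(2)] H_symmetric[OF fd(1) i(1)] by (simp add: i(2))
    qed
    moreover have "coord (H g) \<in> l2" "\<eta> \<in> l2" by (auto simp: g)
    ultimately show "\<eta> \<in> D" using sa unfolding self_adjoint_def by blast
  qed
qed

lemma T_coord: "f \<in> dom \<Longrightarrow> T (coord f) = coord (H f)"
  using T_eq(2) D_eq by blast

text \<open>The commutator of multiplication by \<phi> with a matrix \<open>k\<close> has entries
  \<open>(\<phi> x - \<phi> y) * k x y\<close>. Within propagation \<open>R\<close> the first factor
  is at most \<open>R / r\<close>, so a large \<open>r\<close> makes the Schur bound small; the two
  approximation errors cost \<open>\<delta> / 4\<close> each.\<close>

lemma offdiag_commutator_small:
  assumes \<delta>: "0 < \<delta>"
  shows "\<exists>r>0. \<forall>(\<phi> :: 'a \<Rightarrow> real) f. (\<forall>x. \<bar>\<phi> x\<bar> \<le> 1) \<longrightarrow> (\<forall>x y. \<bar>\<phi> x - \<phi> y\<bar> \<le> dist x y / r) \<longrightarrow>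
    norm (dmult (\<lambda>x. of_real (\<phi> x)) (offdiag f) - offdiag (dmult (\<lambda>x. of_real (\<phi> x)) f)) \<le> \<delta> * norm f"
proof -
  obtain k K R where R: "0 < R" and k: "\<forall>x y. cmod (k x y) \<le> K" "\<forall>x y. k x y \<noteq> 0 \<longrightarrow> dist x y \<le> R"
    and appr: "approximates_offdiagonal T (\<delta> / 4) k"
    using offdiagonal_approximation[OF Cu M, of "\<delta> / 4"] \<delta> by (metis divide_pos_pos zero_less_numeral)
  obtain N where N: "\<forall>x::'a. finite (cball x R) \<and> card (cball x R) \<le> N" using ulf_card[OF ulf R] by blast
  have K: "0 \<le> K" using order_trans[OF norm_ge_zero k(1)[rule_format]] .
  \<comment> \<open>Chosen so that the Schur bound \<open>real N * (R / r * K)\<close> is at most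
    \<open>\<delta> / 2\<close>; the added 1 keeps \<open>r\<close> positive when \<open>K\<close>
    or \<open>N\<close> is 0.\<close>
  define r where "r = 2 * (real N * K * R) / \<delta> + 1"
  have NKR: "0 \<le> real N * K * R" using K R by simp
  have r: "0 < r" using NKR \<delta> by (simp add: r_def add_nonneg_pos)
  have small: "real N * (R / r * K) \<le> \<delta> / 2"
  proof -
    have "2 * (real N * K * R) \<le> \<delta> * r" using \<delta> by (simp add: r_def field_simps)
    thus ?thesis using r by (simp add: field_simps)
  qed
  obtain K' where "bounded_hermitian_matrix (offdiag_col T) K'" using bounded_matrix by blast
  then interpret m: bounded_hermitian_matrix "offdiag_col T" K' .
  have "norm (dmult (\<lambda>x. of_real (\<phi> x)) (offdiag f) - offdiag (dmult (\<lambda>x. of_real (\<phi> x)) f)) \<le> \<delta> * norm f"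
    if \<phi>: "\<And>x. \<bar>\<phi> x\<bar> \<le> 1" and lip: "\<And>x y. \<bar>\<phi> x - \<phi> y\<bar> \<le> dist x y / r"
    for \<phi> :: "'a \<Rightarrow> real" and f
  proof -
    define \<Phi> where "\<Phi> = (dmult (\<lambda>x. of_real (\<phi> x)) :: 'a ell2 \<Rightarrow> 'a ell2)"
    have \<phi>': "cmod (of_real (\<phi> x)) \<le> 1" for x using \<phi> by simp
    have c\<Phi>: "coord (\<Phi> f) x = of_real (\<phi> x) * coord f x" for f x
      unfolding \<Phi>_def by (rule coord_mult[OF \<phi>'])
    have n\<Phi>: "norm (\<Phi> f) \<le> norm f" for f
      unfolding \<Phi>_def using norm_mult_le[OF \<phi>'] by simp
    have bl: "bounded_linear (\<lambda>f. \<Phi> (offdiag f) - offdiag (\<Phi> f))"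
      unfolding \<Phi>_def
      by (intro bounded_linear_sub bounded_linear_compose[OF bounded_linear_mult[OF \<phi>']]
          bounded_linear_compose[OF bounded_linear_B] bounded_linear_B bounded_linear_mult[OF \<phi>'])
    have on_c00: "norm (\<Phi> (offdiag f) - offdiag (\<Phi> f)) \<le> \<delta> * norm f" if f: "coord f \<in> c00" for f
    proof -
      define S where "S = {x. coord f x \<noteq> 0}"
      have S: "finite S" "\<And>x. x \<notin> S \<Longrightarrow> coord f x = 0" "\<And>x. x \<notin> S \<Longrightarrow> coord (\<Phi> f) x = 0"
        using f by (auto simp: S_def c00_def c\<Phi>)
      have "fvec S (coord g) = g" if "\<forall>x. x \<notin> S \<longrightarrow> coord g x = 0" for g
        by (rule ell2_eqI) (use that in \<open>simp add: coord_fvec[OF S(1)]\<close>)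
      hence fS: "fvec S (coord f) = f" "fvec S (coord (\<Phi> f)) = \<Phi> f" using S by blast+
      obtain e1 where e1: "norm e1 \<le> \<delta> / 4 * norm f"
        "\<And>x. (\<Sum>y\<in>S. coord f y * (if x = y then 0 else T (delta y) x)) = coord e1 x + (\<Sum>y\<in>S. k x y * coord f y)"
        using approximates_offdiagonalD[OF appr S(1), of "coord f"] unfolding fS by metis
      obtain e2 where e2: "norm e2 \<le> \<delta> / 4 * norm (\<Phi> f)"
        "\<And>x. (\<Sum>y\<in>S. coord (\<Phi> f) y * (if x = y then 0 else T (delta y) x)) =
          coord e2 x + (\<Sum>y\<in>S. k x y * coord (\<Phi> f) y)"
        using approximates_offdiagonalD[OF appr S(1), of "coord (\<Phi> f)"] unfolding fS by metis
      define k2 where "k2 x y = of_real (\<phi> x - \<phi> y) * k x y" for x y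
      have k2: "cmod (k2 x y) \<le> R / r * K" for x y
      proof (cases "k x y = 0")
        case False
        have "\<bar>\<phi> x - \<phi> y\<bar> \<le> R / r"
          using lip[of x y] divide_right_mono[OF k(2)[rule_format, OF False], of r] r by simp
        hence "\<bar>\<phi> x - \<phi> y\<bar> * cmod (k x y) \<le> R / r * K" using k(1) R r by (intro mult_mono) auto
        thus ?thesis unfolding k2_def norm_mult norm_of_real .
      qed (use K R r in \<open>simp add: k2_def\<close>)
      obtain s where s: "\<And>x. coord s x = (\<Sum>y\<in>S. k2 x y * coord f y)" "norm s \<le> real N * (R / r * K) * norm f"
      proof -
        have "\<forall>x y. k2 x y \<noteq> 0 \<longrightarrow> dist x y \<le> R" using k(2) by (auto simp: k2_def)
        from schur_ell2[OF _ this N S(1), of "R / r * K" "coord f"] k2 that show thesis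
          unfolding fS by blast
      qed
      have "\<Phi> (offdiag f) - offdiag (\<Phi> f) = \<Phi> e1 - e2 + s"
      proof (rule ell2_eqI)
        fix x
        have "coord (offdiag g) x = (\<Sum>y\<in>S. coord g y * (if x = y then 0 else T (delta y) x))"
          if "\<forall>x. x \<notin> S \<longrightarrow> coord g x = 0" for g
          unfolding offdiag_def using that
          by (subst m.coord_matrix_op_finite_support[OF S(1)]) (simp_all add: coord_col)
        hence o: "coord (offdiag f) x = coord e1 x + (\<Sum>y\<in>S. k x y * coord f y)"
          "coord (offdiag (\<Phi> f)) x = coord e2 x + (\<Sum>y\<in>S. k x y * coord (\<Phi> f) y)"
          using S(2,3) e1(2)[of x] e2(2)[of x] by simp_all
        show "coord (\<Phi> (offdiag f) - offdiag (\<Phi> f)) x = coord (\<Phi> e1 - e2 + s) x"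
          unfolding coord_diff coord_add s(1) c\<Phi>[of "offdiag f"] c\<Phi>[of e1] o
          by (simp add: c\<Phi> k2_def algebra_simps sum_distrib_left sum_subtractf)
      qed
      hence "norm (\<Phi> (offdiag f) - offdiag (\<Phi> f)) \<le> norm (\<Phi> e1) + norm e2 + norm s"
        using norm_triangle_ineq[of "\<Phi> e1 - e2" s] norm_triangle_ineq4[of "\<Phi> e1" e2] by simp
      moreover have "norm (\<Phi> e1) \<le> \<delta> / 4 * norm f" using n\<Phi>[of e1] e1(1) by simp
      moreover have "norm e2 \<le> \<delta> / 4 * norm f"
        by (rule order_trans[OF e2(1) mult_left_mono[OF n\<Phi>]]) (use \<delta> in simp)
      moreover have "norm s \<le> \<delta> / 2 * norm f"
        by (rule order_trans[OF s(2) mult_right_mono[OF small]]) simp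
      ultimately show ?thesis by simp
    qed
    have "norm (\<Phi> (offdiag f) - offdiag (\<Phi> f)) \<le> \<delta> * norm f"
      by (rule norm_le_on_dense[OF bl closure_finitely_supported]) (simp add: on_c00)
    thus ?thesis unfolding \<Phi>_def .
  qed
  with r show ?thesis by blast
qed

section \<open>Existence and quasi-locality of the exponential\<close>

lemma exp_exists: "\<exists>W. is_exp_ih D T W"
proof -
  have "generated_group D T (\<lambda>t f. coord (U t (ell2_of f)))"
    by (rule generated_group_of_unitary_group[OF unitary_group_of_U D_eq T_coord])
  thus ?thesis unfolding is_exp_ih_def
    by (intro exI[of _ "\<lambda>f. coord (U 1 (ell2_of f))"] exI[of _ "\<lambda>t f. coord (U t (ell2_of f))"]) simp
qed

lemma exp_quasi_local:
  assumes W1: "is_exp_ih D T W1"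
  shows "quasi_local W1"
proof -
  obtain W where W: "generated_group D T W" and eq: "\<And>f. f \<in> l2 \<Longrightarrow> W1 f = W 1 f"
    using W1 by (auto simp: is_exp_ih_def)
  have "unitary (W 1)" using W unfolding generated_group_def by blast
  hence un: "lin_op l2 (W 1)" "\<And>f. f \<in> l2 \<Longrightarrow> l2norm (W 1 f) = l2norm f" unfolding unitary_def by auto
  have lin1: "lin_op l2 W1"
    using un(1) unfolding lin_op_def by (simp add: eq)
  define V where "V t f = ell2_of (W t (coord f))" for t f
  have V: "unitary_group_of V"
    unfolding V_def by (rule unitary_group_of_generated_group[OF W D_eq T_coord])
  have V1: "coord (V 1 f) = W1 (coord f)" for f
    using linear_of_lin_op(3)[OF un(1), of f] by (simp add: V_def eq)
  have "\<exists>r>0. \<forall>A B. setdist A B > r \<longrightarrow> (\<forall>\<xi>\<in>l2. l2norm (proj A (W1 (proj B \<xi>))) \<le> \<epsilon> * l2norm \<xi>)"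
    if \<epsilon>: "0 < \<epsilon>" for \<epsilon>
  proof -
    obtain r where r: "0 < r"
      "\<forall>(\<phi> :: 'a \<Rightarrow> real) f. (\<forall>x. \<bar>\<phi> x\<bar> \<le> 1) \<longrightarrow> (\<forall>x y. \<bar>\<phi> x - \<phi> y\<bar> \<le> dist x y / r) \<longrightarrow>
        norm (dmult (\<lambda>x. of_real (\<phi> x)) (offdiag f) - offdiag (dmult (\<lambda>x. of_real (\<phi> x)) f)) \<le> \<epsilon> * norm f"
      using offdiag_commutator_small[OF \<epsilon>] by blast
    have "l2norm (proj A (W1 (proj B \<xi>))) \<le> \<epsilon> * l2norm \<xi>"
      if AB: "setdist A B > r" and \<xi>: "\<xi> \<in> l2" for A B :: "'a set" and \<xi>
    proof -
      \<comment> \<open>The cutoff is the distance to \<open>B\<close> in units of \<open>r\<close>,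
        truncated at 1. The choice of \<open>r\<close> depends on \<epsilon> only, not on the two
        sets.\<close>
      define \<phi> where "\<phi> x = min 1 (infdist x B / r)" for x
      define \<Phi> where "\<Phi> = (dmult (\<lambda>x. of_real (\<phi> x)) :: 'a ell2 \<Rightarrow> 'a ell2)"
      have \<phi>1: "\<bar>\<phi> x\<bar> \<le> 1" for x using infdist_nonneg[of x B] r(1) by (simp add: \<phi>_def)
      have "\<bar>\<phi> x - \<phi> y\<bar> \<le> dist x y / r" for x y
      proof -
        have "\<bar>infdist x B - infdist y B\<bar> \<le> dist x y"
          using infdist_triangle[of x B y] infdist_triangle[of y B x] by (simp add: dist_commute abs_le_iff)
        hence "\<bar>infdist x B / r - infdist y B / r\<bar> \<le> dist x y / r"
          using r(1) by (simp add: diff_divide_distrib[symmetric] abs_divide divide_right_mono)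
        thus ?thesis unfolding \<phi>_def by linarith
      qed
      from norm_group_commutator_le[OF V \<phi>1 r(2)[rule_format, OF \<phi>1 this] closure_dom]
      have comm: "norm (\<Phi> (V 1 f) - V 1 (\<Phi> f)) \<le> \<epsilon> * norm f" for f
        unfolding \<Phi>_def .
      have c\<Phi>: "coord (\<Phi> f) x = of_real (\<phi> x) * coord f x" for f x
        unfolding \<Phi>_def by (rule coord_mult[where C = 1]) (use \<phi>1 in simp)
      define f where "f = restr B (ell2_of \<xi>)"
      have f: "coord f = proj B \<xi>" using \<xi> by (simp add: f_def proj_def fun_eq_iff)
      have \<phi>B: "\<phi> x = 0" if "x \<in> B" for x using that by (simp add: \<phi>_def)
      have \<phi>A: "\<phi> x = 1" if "x \<in> A" for x
      proof -
        have "setdist A B \<le> infdist x B"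
          unfolding infdist_eq_setdist using that by (intro setdist_subset_left) auto
        thus ?thesis using AB r(1) by (simp add: \<phi>_def)
      qed
      have "\<Phi> f = 0" by (rule ell2_eqI) (simp add: c\<Phi> f proj_def \<phi>B)
      hence 0: "V 1 (\<Phi> f) = 0" using linear_0[OF group_linear[OF V]] by simp
      \<comment> \<open>\<Phi> annihilates \<open>f\<close> and acts as the identity on
        \<open>A\<close>, so this block of the exponential is also a block of the
        commutator.\<close>
      have "proj A (W1 (proj B \<xi>)) = coord (restr A (\<Phi> (V 1 f) - V 1 (\<Phi> f)))"
        unfolding f[symmetric] V1[symmetric] 0 by (auto simp: proj_def fun_eq_iff c\<Phi> \<phi>A)
      hence "l2norm (proj A (W1 (proj B \<xi>))) \<le> norm (\<Phi> (V 1 f) - V 1 (\<Phi> f))"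
        using norm_restr_le by (simp only: norm_ell2_l2norm[symmetric])
      also have "\<dots> \<le> \<epsilon> * norm f" by (rule comm)
      also have "\<dots> \<le> \<epsilon> * l2norm \<xi>"
        using norm_restr_le[of B "ell2_of \<xi>"] \<epsilon> \<xi> by (simp add: f_def l2norm_ell2_of)
      finally show ?thesis .
    qed
    thus ?thesis using r(1) by blast
  qed
  moreover have "\<forall>\<xi>\<in>l2. l2norm (W1 \<xi>) \<le> 1 * l2norm \<xi>" using un(2) eq by simp
  ultimately show ?thesis unfolding quasi_local_def using lin1 by blast
qed

end

subsection \<open>Coarse operators\<close>

lemma vtrans_id: "vtrans S id = proj S"
  by (auto simp: vtrans_def proj_def fun_eq_iff the_inv_into_f_f[of id S, simplified])

text \<open>Otherwise there are entries of modulus larger than \<open>n\<close> at positions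
  \<open>(a n, b n)\<close> such that no \<open>a m\<close> equals any \<open>b n\<close>. The
  projection onto the points \<open>a n\<close> kills \<open>delta (b n)\<close>, so its commutator
  with \<open>T\<close> sends that unit vector to a vector having such an entry, and cannot be
  bounded.\<close>

lemma coarse_offdiagonal_bounded:
  fixes D :: "'a::metric_space vec set"
  assumes ulf: "unif_loc_finite TYPE('a)" and Cu: "in_Cu_unb D T" and coarse: "coarse_op D T"
  shows "\<exists>M. \<forall>x y. x \<noteq> y \<longrightarrow> cmod (T (delta y) x) \<le> M"
proof (rule ccontr)
  assume "\<not> ?thesis"
  hence unbounded: "\<exists>x y. x \<noteq> y \<and> cmod (T (delta y) x) > M" for M
    by (meson not_le_imp_less)
  obtain T' :: "'a vec \<Rightarrow> 'a vec" and R where R: "0 < R" "\<And>x y. T' (delta y) x \<noteq> 0 \<Longrightarrow> dist x y \<le> R"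
    and entry: "\<And>x y. cmod (T (delta y) x - T' (delta y) x) \<le> 1"
    using Cu_unb_approximation[OF Cu zero_less_one] by metis
  \<comment> \<open>Rows and columns through a finite set meet only finitely many nonzero entries of
    the finite propagation approximant, and \<open>T\<close> differs from it entrywise by at most
    1.\<close>
  have fin: "\<exists>C. \<forall>x y. x \<in> F \<or> y \<in> F \<longrightarrow> cmod (T (delta y) x) \<le> C" if F: "finite F" for F
  proof -
    define P where "P = (SIGMA x:F. cball x R) \<union> (\<lambda>(x, y). (y, x)) ` (SIGMA x:F. cball x R)"
    have "finite (cball x R)" for x :: 'a using ulf R(1) unfolding unif_loc_finite_def by blast
    hence "finite P" using F by (auto simp: P_def)
    hence "bounded ((\<lambda>(x, y). T' (delta y) x) ` P)" by (intro finite_imp_bounded finite_imageI)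
    then obtain C where C: "\<And>x y. (x, y) \<in> P \<Longrightarrow> cmod (T' (delta y) x) \<le> C"
      unfolding bounded_iff by fastforce
    have "cmod (T (delta y) x) \<le> \<bar>C\<bar> + 1" if xy: "x \<in> F \<or> y \<in> F" for x y
    proof -
      have "cmod (T' (delta y) x) \<le> \<bar>C\<bar>"
      proof (cases "T' (delta y) x = 0")
        case False
        have "(x, y) \<in> P"
          using R(2)[OF False] xy by (auto simp: P_def dist_commute image_iff)
        thus ?thesis using C by fastforce
      qed simp
      thus ?thesis using entry[of y x] norm_triangle_sub[of "T (delta y) x" "T' (delta y) x"] by linarith
    qed
    thus ?thesis by blast
  qed
  have step: "\<exists>x y. x \<noteq> y \<and> x \<notin> F \<and> y \<notin> F \<and> cmod (T (delta y) x) > real n" if F: "finite F" for F n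
  proof -
    obtain C where C: "\<And>x y. x \<in> F \<or> y \<in> F \<Longrightarrow> cmod (T (delta y) x) \<le> C" using fin[OF F] by blast
    \<comment> \<open>An entry larger than \<open>C\<close> has neither index in
      \<open>F\<close>.\<close>
    obtain x y where "x \<noteq> y" "cmod (T (delta y) x) > max C (real n)" using unbounded by blast
    thus ?thesis using C[of x y] by (intro exI[of _ x] exI[of _ y]) auto
  qed
  \<comment> \<open>\<open>F\<close> collects all points used so far; carrying it along in the
    recursion lets each new pair avoid every earlier one.\<close>
  define Q where "Q n p \<longleftrightarrow> (case p of (F, x, y) \<Rightarrow> finite F \<and> x \<in> F \<and> y \<in> F \<and> x \<noteq> y \<and> cmod (T (delta y) x) > real n)"
    for n and p :: "'a set \<times> 'a \<times> 'a"
  have "\<exists>p. \<forall>n. Q n (p n) \<and> fst (p n) \<subseteq> fst (p (Suc n)) \<and> fst (snd (p (Suc n))) \<notin> fst (p n)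
    \<and> snd (snd (p (Suc n))) \<notin> fst (p n)"
  proof (rule dependent_nat_choice)
    obtain x y where "x \<noteq> y" "cmod (T (delta y) x) > real 0" using step[of "{}" 0] by auto
    thus "\<exists>p. Q 0 p" by (intro exI[of _ "({x, y}, x, y)"]) (simp add: Q_def)
    fix p n assume "Q n p"
    hence "finite (fst p)" by (auto simp: Q_def split: prod.splits)
    from step[OF this, of "Suc n"] obtain x y where
      "x \<noteq> y" "x \<notin> fst p" "y \<notin> fst p" "cmod (T (delta y) x) > real (Suc n)" by blast
    thus "\<exists>q. Q (Suc n) q \<and> fst p \<subseteq> fst q \<and> fst (snd q) \<notin> fst p \<and> snd (snd q) \<notin> fst p"
      using \<open>finite (fst p)\<close> by (intro exI[of _ "(insert x (insert y (fst p)), x, y)"]) (auto simp: Q_def)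
  qed
  then obtain p where p: "\<And>n. Q n (p n)" "\<And>n. fst (p n) \<subseteq> fst (p (Suc n))"
    "\<And>n. fst (snd (p (Suc n))) \<notin> fst (p n)" "\<And>n. snd (snd (p (Suc n))) \<notin> fst (p n)" by blast
  define F a b where "F n = fst (p n)" and "a n = fst (snd (p n))" and "b n = snd (snd (p n))" for n
  have ab: "a n \<in> F n" "b n \<in> F n" "a n \<noteq> b n" "cmod (T (delta (b n)) (a n)) > real n" for n
    using p(1)[of n] by (auto simp: Q_def F_def a_def b_def split: prod.splits)
  have F_mono: "F m \<subseteq> F n" if "m \<le> n" for m n
    by (rule lift_Suc_mono_le[of F, OF _ that]) (simp add: F_def p(2))
  have new: "a n \<notin> F m \<and> b n \<notin> F m" if "m < n" for m n
  proof (cases n)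
    case (Suc n')
    thus ?thesis using p(3,4)[of n'] F_mono[of m n'] that by (auto simp: F_def a_def b_def)
  qed (use that in simp)
  have disj: "a m \<noteq> b n" for m n
    using new[of m n] new[of n m] ab(1)[of m] ab(2)[of n] ab(3)[of m] by (cases m n rule: linorder_cases) auto
  have "partial_translation (range a) id" by (auto simp: partial_translation_def)
  then obtain C where C: "\<And>\<xi>. \<xi> \<in> D \<Longrightarrow> l2norm (T (proj (range a) \<xi>) - proj (range a) (T \<xi>)) \<le> C * l2norm \<xi>"
    using coarse unfolding coarse_op_def vtrans_id[symmetric] by blast
  obtain n where n: "real n > C" using reals_Archimedean2 by blast
  note lin = Cu_unb_lin_op[OF Cu]
  have \<delta>: "delta (b n) \<in> D" by (rule delta_in_domain[OF lin(2)])
  have T\<delta>: "T (delta (b n)) \<in> l2" by (rule lin_op_l2[OF lin(1) \<delta>])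
  have "proj (range a) (delta (b n)) = 0"
    using disj[THEN not_sym] by (auto simp: proj_def delta_def fun_eq_iff)
  hence "l2norm (- proj (range a) (T (delta (b n)))) \<le> C"
    using C[OF \<delta>] lin_op_0[OF lin(1)] by (simp add: l2norm_delta)
  moreover have "cmod ((- proj (range a) (T (delta (b n)))) (a n)) \<le> l2norm (- proj (range a) (T (delta (b n))))"
    by (rule cmod_le_l2norm, rule l2_mono[OF T\<delta>, where C = 1]) (simp add: proj_def)
  moreover have "cmod ((- proj (range a) (T (delta (b n)))) (a n)) = cmod (T (delta (b n)) (a n))"
    by (simp add: proj_def)
  ultimately show False using ab(4)[of n] n by linarith
qed

theorem theorem7p1p3:
  assumes "unif_loc_finite TYPE('a::metric_space)"
  shows "(\<forall>(D :: 'a vec set) T.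
            self_adjoint D T \<and> in_Cu_unb D T \<and>
            (\<exists>M. \<forall>x y. x \<noteq> y \<longrightarrow> cmod (l2inner (T (delta y)) (delta x)) \<le> M)
            \<longrightarrow> (\<exists>U. is_exp_ih D T U) \<and> (\<forall>U. is_exp_ih D T U \<longrightarrow> quasi_local U))
       \<and> (\<forall>(D :: 'a vec set) T.
            self_adjoint D T \<and> in_Cu_unb D T \<and> coarse_op D T
            \<longrightarrow> (\<exists>U. is_exp_ih D T U) \<and> (\<forall>U. is_exp_ih D T U \<longrightarrow> quasi_local U))"
proof -
  have main: "(\<exists>U. is_exp_ih D T U) \<and> (\<forall>U. is_exp_ih D T U \<longrightarrow> quasi_local U)"
    if "self_adjoint D T" "in_Cu_unb D T" and M: "\<exists>M. \<forall>x y. x \<noteq> y \<longrightarrow> cmod (T (delta y) x) \<le> M"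
    for D :: "'a vec set" and T
  proof -
    obtain M where "\<forall>x y. x \<noteq> y \<longrightarrow> cmod (T (delta y) x) \<le> M" using M by blast
    then interpret selfadjoint_Cu D T M
      using assms that(1,2) by unfold_locales
    show ?thesis using exp_exists exp_quasi_local by blast
  qed
  show ?thesis
    unfolding l2inner_delta_right by (intro conjI allI impI; elim conjE)
      (use main coarse_offdiagonal_bounded[OF assms] in metis)+
qed

end
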